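(* Suppose $\lambda_1 \subseteq \lambda_2 \subseteq \lambda_3 \subseteq \cdots$ is a sequence of Young diagrams such that $\lambda_n$ has $n$ boxes for each $n\ge 1$. For each $n$ let $R_n=\mathbb{C}[x_1,\ldots,x_n]$ and let $I_{\lambda_n}\subseteq R_n$ be the Tanisaki ideal of $\lambda_n$. Then the sequence $\{R_n/I_{\lambda_n}\}_{n\ge 1}$ (with the maps induced by the co-FI-algebra structure on $\{R_n\}$) forms a graded co-FI-module of finite type.
   Context: Partitions $\lambda=(\lambda_1\ge\lambda_2\ge\cdots)$ are identified with Young diagrams (left-justified rows, the longest row on top); $\lambda\subseteq\lambda'$ means containment of diagrams. Tanisaki ideal. For $S\subseteq\{x_1,\ldots,x_n\}$ let $e_i(S)=\sum_{T\subseteq S,\,|T|=i}\prod_{x_j\in T}x_j$. Let $E_{i,j}^n$ be the set of all $e_i(S)$ with $S\subseteq\{x_1,\ldots,x_n\}$, $|S|=j$. For a partition $\lambda$ of $n$, the BFR-filling of $\lambda$ is obtained as follows: going through the columns from leftmost to rightmost, place the numbers $1,2,\ldots,n-\lambda_1$ bottom to top in each column, skipping the top row; then fill the top row from right to left with $n-\lambda_1+1,\ldots,n$. The set $\mathcal{G}(\lambda)$ is the union, over all boxes of $\lambda$, of the sets $E_{i,j}^n$ where $i$ is the entry of the box and $j$ is the entry of the top-row box in the same column. The Tanisaki ideal $I_\lambda\subseteq R_n=\mathbb{C}[x_1,\ldots,x_n]$ is the ideal generated by $\mathcal{G}(\lambda)$ (by a theorem of Biagioli–Faridi–Rosas this agrees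 with Tanisaki's original definition). It is homogeneous and invariant under permuting the variables, and $R_n/I_\lambda$ is graded by polynomial degree. FI and co-FI. FI is the category with objects $\mathbf{n}=\{1,\ldots,n\}$ and morphisms injections $\mathbf{m}\to\mathbf{n}$; co-FI is the opposite category. A (graded) FI-module (resp. co-FI-module) is a functor from FI (resp. co-FI) to (graded) $\mathbb{C}$-vector spaces; FI- and co-FI-algebras are defined likewise. The sequence $\{R_n\}$ is a graded co-FI-algebra: an injection $f:\mathbf{m}\to\mathbf{n}$ induces the ring homomorphism $f^*:R_n\to R_m$ with $f^*(x_i)=x_{f^{-1}(i)}$ if $i\in\mathrm{Im}(f)$ and $f^*(x_i)=0$ otherwise. An FI-module $V$ is finitely generated if there is a finite set $S$ of elements of $\coprod_i V_i$ such that no proper sub-FI-module of $V$ contains $S$. A graded FI-module has finite type if its $i$-th graded part is a finitely generated FI-module for each $i$. A graded co-FI-module has finite type if its (graded) dual is a graded FI-module of finite type. *)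

theory Defs
  imports Complex_Main "HOL-Algebra.QuotRing" "HOL-Algebra.Module" "HOL-Library.Poly_Mapping"
begin

section \<open>Complex vector spaces and linear maps\<close>

text \<open>The field of complex numbers, regarded as a vector space over itself.  Being a record that
  extends \<^typ>\<open>complex ring\<close>, it also serves as the base ring, so that a complex vector space
  is a structure \<open>V\<close> with \<open>module complex_field V\<close>.\<close>

definition complex_field :: "(complex, complex) module" where
  "complex_field = \<lparr>carrier = UNIV, mult = (*), one = 1, zero = 0, add = (+), smult = (*)\<rparr>"

lemma field_complex_field: "field complex_field"
proof (rule cring.cring_fieldI2)
  show "cring complex_field"
    by (rule cringI)
      (auto simp: complex_field_def algebra_simps
        intro!: abelian_groupI comm_monoidI exI[of _ "- x" for x])
  show "\<zero>\<^bsub>complex_field\<^esub> \<noteq> \<one>\<^bsub>complex_field\<^esub>"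
    by (simp add: complex_field_def)
  show "\<exists>b\<in>carrier complex_field. a \<otimes>\<^bsub>complex_field\<^esub> b = \<one>\<^bsub>complex_field\<^esub>"
    if "a \<noteq> \<zero>\<^bsub>complex_field\<^esub>" for a
    using that by (auto simp: complex_field_def intro!: exI[of _ "inverse a"])
qed

definition lin_hom :: "(complex, 'a) module \<Rightarrow> (complex, 'b) module \<Rightarrow> ('a \<Rightarrow> 'b) set" where
  "lin_hom V W = {T \<in> carrier V \<rightarrow> carrier W.
     (\<forall>x\<in>carrier V. \<forall>y\<in>carrier V. T (x \<oplus>\<^bsub>V\<^esub> y) = T x \<oplus>\<^bsub>W\<^esub> T y) \<and>
     (\<forall>c. \<forall>x\<in>carrier V. T (c \<odot>\<^bsub>V\<^esub> x) = c \<odot>\<^bsub>W\<^esub> T x)}"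

text \<open>An internally graded vector space: the direct sum of the subspaces \<open>G d\<close>.\<close>

locale graded_vector_space =
  fixes V :: "(complex, 'a) module" and G :: "nat \<Rightarrow> 'a set"
  assumes vector_space: "module complex_field V"
    and graded_part: "submodule (G d) complex_field V"
    and direct_sum: "x \<in> carrier V \<Longrightarrow>
      \<exists>!c. (\<forall>d. c d \<in> G d) \<and> finite {d. c d \<noteq> \<zero>\<^bsub>V\<^esub>} \<and>
        x = (\<Oplus>\<^bsub>V\<^esub>d\<in>{d. c d \<noteq> \<zero>\<^bsub>V\<^esub>}. c d)"


section \<open>FI-modules and co-FI-modules\<close>

text \<open>Objects are the sets \<open>{1..n}\<close> for \<open>n \<ge> 1\<close>.  Morphisms are extensional functions,
  so that equality of morphisms is equality of functions; composition is \<^const>\<open>compose\<close>.\<close>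

definition fi_hom :: "nat \<Rightarrow> nat \<Rightarrow> (nat \<Rightarrow> nat) set" where
  "fi_hom m n = {f \<in> {1..m} \<rightarrow>\<^sub>E {1..n}. inj_on f {1..m}}"

definition fi_id :: "nat \<Rightarrow> nat \<Rightarrow> nat" where
  "fi_id n = (\<lambda>i\<in>{1..n}. i)"

definition fi_comp :: "nat \<Rightarrow> (nat \<Rightarrow> nat) \<Rightarrow> (nat \<Rightarrow> nat) \<Rightarrow> nat \<Rightarrow> nat" where
  "fi_comp l g f = compose {1..l} g f"

text \<open>\<open>act m n f\<close> is the map induced by \<open>f \<in> fi_hom m n\<close>: it goes from \<open>V m\<close> to \<open>V n\<close> in an
  FI-module, and from \<open>V n\<close> to \<open>V m\<close> in a co-FI-module.\<close>

locale fi_module =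
  fixes V :: "nat \<Rightarrow> (complex, 'a) module"
    and act :: "nat \<Rightarrow> nat \<Rightarrow> (nat \<Rightarrow> nat) \<Rightarrow> 'a \<Rightarrow> 'a"
  assumes vector_space: "1 \<le> n \<Longrightarrow> module complex_field (V n)"
    and act_hom: "1 \<le> m \<Longrightarrow> 1 \<le> n \<Longrightarrow> f \<in> fi_hom m n \<Longrightarrow> act m n f \<in> lin_hom (V m) (V n)"
    and act_id: "1 \<le> n \<Longrightarrow> x \<in> carrier (V n) \<Longrightarrow> act n n (fi_id n) x = x"
    and act_comp: "1 \<le> l \<Longrightarrow> 1 \<le> m \<Longrightarrow> 1 \<le> n \<Longrightarrow> f \<in> fi_hom l m \<Longrightarrow> g \<in> fi_hom m n \<Longrightarrow>
      x \<in> carrier (V l) \<Longrightarrow> act l n (fi_comp l g f) x = act m n g (act l m f x)"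

locale cofi_module =
  fixes V :: "nat \<Rightarrow> (complex, 'a) module"
    and act :: "nat \<Rightarrow> nat \<Rightarrow> (nat \<Rightarrow> nat) \<Rightarrow> 'a \<Rightarrow> 'a"
  assumes vector_space: "1 \<le> n \<Longrightarrow> module complex_field (V n)"
    and act_hom: "1 \<le> m \<Longrightarrow> 1 \<le> n \<Longrightarrow> f \<in> fi_hom m n \<Longrightarrow> act m n f \<in> lin_hom (V n) (V m)"
    and act_id: "1 \<le> n \<Longrightarrow> x \<in> carrier (V n) \<Longrightarrow> act n n (fi_id n) x = x"
    and act_comp: "1 \<le> l \<Longrightarrow> 1 \<le> m \<Longrightarrow> 1 \<le> n \<Longrightarrow> f \<in> fi_hom l m \<Longrightarrow> g \<in> fi_hom m n \<Longrightarrow>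
      x \<in> carrier (V n) \<Longrightarrow> act l n (fi_comp l g f) x = act l m f (act m n g x)"

locale graded_fi_module = fi_module V act
  for V :: "nat \<Rightarrow> (complex, 'a) module" and G :: "nat \<Rightarrow> nat \<Rightarrow> 'a set"
    and act :: "nat \<Rightarrow> nat \<Rightarrow> (nat \<Rightarrow> nat) \<Rightarrow> 'a \<Rightarrow> 'a" +
  assumes graded: "1 \<le> n \<Longrightarrow> graded_vector_space (V n) (G n)"
    and act_graded: "1 \<le> m \<Longrightarrow> 1 \<le> n \<Longrightarrow> f \<in> fi_hom m n \<Longrightarrow> act m n f ` G m d \<subseteq> G n d"

locale graded_cofi_module = cofi_module V act
  for V :: "nat \<Rightarrow> (complex, 'a) module" and G :: "nat \<Rightarrow> nat \<Rightarrow> 'a set"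
    and act :: "nat \<Rightarrow> nat \<Rightarrow> (nat \<Rightarrow> nat) \<Rightarrow> 'a \<Rightarrow> 'a" +
  assumes graded: "1 \<le> n \<Longrightarrow> graded_vector_space (V n) (G n)"
    and act_graded: "1 \<le> m \<Longrightarrow> 1 \<le> n \<Longrightarrow> f \<in> fi_hom m n \<Longrightarrow> act m n f ` G n d \<subseteq> G m d"

definition sub_fi_module ::
  "(nat \<Rightarrow> (complex, 'a) module) \<Rightarrow> (nat \<Rightarrow> nat \<Rightarrow> (nat \<Rightarrow> nat) \<Rightarrow> 'a \<Rightarrow> 'a) \<Rightarrow> (nat \<Rightarrow> 'a set) \<Rightarrow> bool"
  where "sub_fi_module V act W \<longleftrightarrow>
    (\<forall>n\<ge>1. submodule (W n) complex_field (V n)) \<and>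
    (\<forall>m\<ge>1. \<forall>n\<ge>1. \<forall>f\<in>fi_hom m n. act m n f ` W m \<subseteq> W n)"

definition finitely_generated_fi_module ::
  "(nat \<Rightarrow> (complex, 'a) module) \<Rightarrow> (nat \<Rightarrow> nat \<Rightarrow> (nat \<Rightarrow> nat) \<Rightarrow> 'a \<Rightarrow> 'a) \<Rightarrow> bool"
  where "finitely_generated_fi_module V act \<longleftrightarrow> fi_module V act \<and>
    (\<exists>S. finite S \<and> S \<subseteq> Sigma {1..} (\<lambda>n. carrier (V n)) \<and>
      (\<forall>W. sub_fi_module V act W \<and> (\<forall>(n, x)\<in>S. x \<in> W n) \<longrightarrow> (\<forall>n\<ge>1. W n = carrier (V n))))"

definition fi_finite_type ::
  "(nat \<Rightarrow> (complex, 'a) module) \<Rightarrow> (nat \<Rightarrow> nat \<Rightarrow> 'a set) \<Rightarrow>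
    (nat \<Rightarrow> nat \<Rightarrow> (nat \<Rightarrow> nat) \<Rightarrow> 'a \<Rightarrow> 'a) \<Rightarrow> bool"
  where "fi_finite_type V G act \<longleftrightarrow> graded_fi_module V G act \<and>
    (\<forall>d. finitely_generated_fi_module (\<lambda>n. (V n)\<lparr>carrier := G n d\<rparr>) act)"

text \<open>The graded dual consists of the functionals that vanish on all but finitely many graded
  parts, i.e. it is the direct sum of the duals of the graded parts.  Functionals are extensional
  on the carrier.  The fields \<open>mult\<close> and \<open>one\<close> are irrelevant to the vector space structure.\<close>

definition graded_dual ::
  "(complex, 'a) module \<Rightarrow> (nat \<Rightarrow> 'a set) \<Rightarrow> (complex, 'a \<Rightarrow> complex) module"
  where "graded_dual V G =
    \<lparr>carrier = {\<phi> \<in> lin_hom V complex_field \<inter> extensional (carrier V).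
       finite {d. \<exists>x\<in>G d. \<phi> x \<noteq> 0}},
     mult = undefined, one = undefined,
     zero = (\<lambda>x\<in>carrier V. 0),
     add = (\<lambda>\<phi> \<psi>. \<lambda>x\<in>carrier V. \<phi> x + \<psi> x),
     smult = (\<lambda>c \<phi>. \<lambda>x\<in>carrier V. c * \<phi> x)\<rparr>"

definition dual_grading ::
  "(complex, 'a) module \<Rightarrow> (nat \<Rightarrow> 'a set) \<Rightarrow> nat \<Rightarrow> ('a \<Rightarrow> complex) set"
  where "dual_grading V G d =
    {\<phi> \<in> carrier (graded_dual V G). \<forall>e. e \<noteq> d \<longrightarrow> (\<forall>x\<in>G e. \<phi> x = 0)}"

definition dual_act ::
  "(nat \<Rightarrow> (complex, 'a) module) \<Rightarrow> (nat \<Rightarrow> nat \<Rightarrow> (nat \<Rightarrow> nat) \<Rightarrow> 'a \<Rightarrow> 'a) \<Rightarrow>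
    nat \<Rightarrow> nat \<Rightarrow> (nat \<Rightarrow> nat) \<Rightarrow> ('a \<Rightarrow> complex) \<Rightarrow> 'a \<Rightarrow> complex"
  where "dual_act V act m n f \<phi> = (\<lambda>x\<in>carrier (V n). \<phi> (act m n f x))"

definition cofi_finite_type ::
  "(nat \<Rightarrow> (complex, 'a) module) \<Rightarrow> (nat \<Rightarrow> nat \<Rightarrow> 'a set) \<Rightarrow>
    (nat \<Rightarrow> nat \<Rightarrow> (nat \<Rightarrow> nat) \<Rightarrow> 'a \<Rightarrow> 'a) \<Rightarrow> bool"
  where "cofi_finite_type V G act \<longleftrightarrow> graded_cofi_module V G act \<and>
    fi_finite_type (\<lambda>n. graded_dual (V n) (G n)) (\<lambda>n. dual_grading (V n) (G n)) (dual_act V act)"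


section \<open>Polynomial rings and their co-FI structure\<close>

type_synonym monomial = "nat \<Rightarrow>\<^sub>0 nat"
type_synonym cpoly = "monomial \<Rightarrow>\<^sub>0 complex"

definition poly_var :: "nat \<Rightarrow> cpoly" where
  "poly_var i = Poly_Mapping.single (Poly_Mapping.single i 1) 1"

definition poly_const :: "complex \<Rightarrow> cpoly" where
  "poly_const c = Poly_Mapping.single 0 c"

definition poly_ring :: "nat \<Rightarrow> (complex, cpoly) module" where
  "poly_ring n =
    \<lparr>carrier = {p. \<forall>u\<in>Poly_Mapping.keys p. Poly_Mapping.keys u \<subseteq> {1..n}},
     mult = (*), one = 1, zero = 0, add = (+), smult = (\<lambda>c p. poly_const c * p)\<rparr>"

definition mon_degree :: "monomial \<Rightarrow> nat" where
  "mon_degree u = (\<Sum>i\<in>Poly_Mapping.keys u. Poly_Mapping.lookup u i)"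

definition homogeneous_polys :: "nat \<Rightarrow> nat \<Rightarrow> cpoly set" where
  "homogeneous_polys n d =
    {p \<in> carrier (poly_ring n). \<forall>u\<in>Poly_Mapping.keys p. mon_degree u = d}"

definition poly_subst :: "(nat \<Rightarrow> cpoly) \<Rightarrow> cpoly \<Rightarrow> cpoly" where
  "poly_subst \<sigma> p = (\<Sum>u\<in>Poly_Mapping.keys p.
     poly_const (Poly_Mapping.lookup p u) *
       (\<Prod>i\<in>Poly_Mapping.keys u. \<sigma> i ^ Poly_Mapping.lookup u i))"

definition poly_pullback :: "nat \<Rightarrow> (nat \<Rightarrow> nat) \<Rightarrow> cpoly \<Rightarrow> cpoly" where
  "poly_pullback m f = poly_subst
     (\<lambda>i. if i \<in> f ` {1..m} then poly_var (the_inv_into {1..m} f i) else 0)"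


section \<open>Young diagrams and Tanisaki ideals\<close>

text \<open>Rows and columns are numbered from 0, and \<open>lam r\<close> is the length of row \<open>r\<close>; row 0 is the
  top row.  A box is a pair (row, column).\<close>

definition is_partition :: "(nat \<Rightarrow> nat) \<Rightarrow> bool" where
  "is_partition lam \<longleftrightarrow> antimono lam \<and> finite {r. lam r \<noteq> 0}"

definition diagram :: "(nat \<Rightarrow> nat) \<Rightarrow> (nat \<times> nat) set" where
  "diagram lam = {(r, c). c < lam r}"

definition num_boxes :: "(nat \<Rightarrow> nat) \<Rightarrow> nat" where
  "num_boxes lam = card (diagram lam)"

definition col_height :: "(nat \<Rightarrow> nat) \<Rightarrow> nat \<Rightarrow> nat" where
  "col_height lam c = card {r. c < lam r}"

text \<open>The BFR-filling.  A column \<open>c'\<close> of the diagram has \<open>col_height lam c' - 1\<close> boxes below the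
  top row; these are filled column by column from the left, each from its lowest box (row
  \<open>col_height lam c' - 1\<close>) up to row 1.  The top row then receives the remaining numbers from
  right to left, the last of which, \<open>num_boxes lam\<close>, ends up in column 0.\<close>

fun bfr_entry :: "(nat \<Rightarrow> nat) \<Rightarrow> nat \<times> nat \<Rightarrow> nat" where
  "bfr_entry lam (r, c) =
    (if r = 0 then num_boxes lam - c
     else (\<Sum>c'<c. col_height lam c' - 1) + (col_height lam c - r))"

definition elem_sym :: "nat \<Rightarrow> nat set \<Rightarrow> cpoly" where
  "elem_sym i S = (\<Sum>T\<in>{T. T \<subseteq> S \<and> card T = i}. \<Prod>j\<in>T. poly_var j)"

definition elem_sym_set :: "nat \<Rightarrow> nat \<Rightarrow> nat \<Rightarrow> cpoly set" where
  "elem_sym_set n i j = {elem_sym i S |S. S \<subseteq> {1..n} \<and> card S = j}"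

definition tanisaki_generators :: "(nat \<Rightarrow> nat) \<Rightarrow> cpoly set" where
  "tanisaki_generators lam =
    (\<Union>(r, c)\<in>diagram lam.
      elem_sym_set (num_boxes lam) (bfr_entry lam (r, c)) (bfr_entry lam (0, c)))"

definition tanisaki_ideal :: "(nat \<Rightarrow> nat) \<Rightarrow> cpoly set" where
  "tanisaki_ideal lam = genideal (poly_ring (num_boxes lam)) (tanisaki_generators lam)"


section \<open>The quotients\<close>

text \<open>Elements of a quotient are cosets.  As in \<^const>\<open>rcoset_mult\<close>, an operation on cosets is
  given by the union of the cosets of the results on representatives; this is a single coset
  precisely when the operation is well defined on the quotient.\<close>

definition algebra_quot :: "(complex, 'a) module \<Rightarrow> 'a set \<Rightarrow> (complex, 'a set) module" where
  "algebra_quot A I =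
    \<lparr>carrier = carrier (A Quot I), mult = mult (A Quot I), one = one (A Quot I),
     zero = zero (A Quot I), add = add (A Quot I),
     smult = (\<lambda>c X. \<Union>a\<in>X. I +>\<^bsub>A\<^esub> (c \<odot>\<^bsub>A\<^esub> a))\<rparr>"

definition tanisaki_quot :: "(nat \<Rightarrow> nat) \<Rightarrow> (complex, cpoly set) module" where
  "tanisaki_quot lam = algebra_quot (poly_ring (num_boxes lam)) (tanisaki_ideal lam)"

definition tanisaki_grading :: "(nat \<Rightarrow> nat) \<Rightarrow> nat \<Rightarrow> cpoly set set" where
  "tanisaki_grading lam d =
    (\<lambda>p. tanisaki_ideal lam +>\<^bsub>poly_ring (num_boxes lam)\<^esub> p) ` homogeneous_polys (num_boxes lam) d"

definition tanisaki_pullback ::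
  "(nat \<Rightarrow> nat \<Rightarrow> nat) \<Rightarrow> nat \<Rightarrow> nat \<Rightarrow> (nat \<Rightarrow> nat) \<Rightarrow> cpoly set \<Rightarrow> cpoly set"
  where "tanisaki_pullback Lam m n f X =
    (\<Union>p\<in>X. tanisaki_ideal (Lam m) +>\<^bsub>poly_ring m\<^esub> poly_pullback m f p)"

end

theory Submission
  imports Defs "HOL-Library.Infinite_Set"
begin

text \<open>
  Two facts carry the theorem.  The first is combinatorial: the Tanisaki ideals of the chain are
  compatible with the co-FI structure.  The second is a finiteness principle that holds for the
  quotients of \<open>{R\<^sub>n}\<close> by any system of homogeneous ideals with this compatibility.

  Compatibility.  The pullback along an injection \<open>f\<close> from \<open>{1..m}\<close> to \<open>{1..n}\<close> sends
  \<open>e\<^sub>i(S)\<close> to \<open>e\<^sub>i(P)\<close>, where \<open>P\<close> is the preimage of \<open>S\<close>.  For a partition \<open>\<lambda>\<close> of \<open>n\<close> let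
  \<open>B\<^sub>\<lambda>(c)\<close> be the number of boxes below the top row in the first \<open>c\<close> columns.  A generator
  attached to a box of column \<open>c\<close> is some \<open>e\<^sub>i(S)\<close> with \<open>|S| = n - c\<close> and \<open>i > B\<^sub>\<lambda>(c)\<close>.
  Conversely, \<open>I\<^sub>\<lambda>\<close> contains every such \<open>e\<^sub>i(S)\<close> (\<open>elem_sym_mem_tanisaki_ideal\<close>): the
  entries of column \<open>c\<close> cover \<open>B\<^sub>\<lambda>(c) < i \<le> B\<^sub>\<lambda>(c + 1)\<close> and \<open>i = n - c\<close>, and for the values of \<open>i\<close>
  in between, \<open>e\<^sub>i(S)\<close> is an average of the polynomials \<open>e\<^sub>i(S - {x})\<close> of the next column.
  If \<open>\<mu> \<subseteq> \<lambda>\<close> has \<open>m\<close> boxes and \<open>|S| = n - c\<close>, then \<open>|P| = m - c'\<close> with \<open>c' \<le> c\<close>, and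
  \<open>B\<^sub>\<mu>(c') \<le> B\<^sub>\<mu>(c) \<le> B\<^sub>\<lambda>(c)\<close>; hence generators of \<open>I\<^sub>\<lambda>\<close> are pulled back into \<open>I\<^sub>\<mu>\<close>
  (\<open>tanisaki_ideal_pullback\<close>).

  Finiteness.  A functional on the degree \<open>d\<close> part of \<open>R\<^sub>n/I\<^sub>n\<close> is determined by its values
  on the monomials of degree \<open>d\<close>, so the dual is an FI-submodule of the functions on these
  monomials.  Such FI-modules are finitely generated
  (\<open>finitely_generated_by_leading_monomials\<close>), by a Groebner argument: order monomials
  lexicographically and consider the leading monomial of each element.  An order-preserving
  injection carries leading monomials to leading monomials.  Written as words of exponents,
  the leading monomials of degree \<open>d\<close> are words of sum \<open>d\<close>, and an order-preserving injection
  inserts zeros into a word.  Words of fixed sum are well-quasi-ordered by insertion of zeros, so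
  finitely many elements have leading monomials from which all others arise, and subtracting
  multiples of images of these elements reduces every element to zero.
\<close>

section \<open>Inserting zeros into words\<close>

inductive zero_insertion :: "nat list \<Rightarrow> nat list \<Rightarrow> bool" where
  Nil: "zero_insertion [] []"
| keep: "zero_insertion xs ys \<Longrightarrow> zero_insertion (x # xs) (x # ys)"
| new: "zero_insertion xs ys \<Longrightarrow> zero_insertion xs (0 # ys)"

lemma zero_insertion_length: "zero_insertion xs ys \<Longrightarrow> length xs \<le> length ys"
  by (induction rule: zero_insertion.induct) auto

lemma zero_insertion_eq:
  "zero_insertion xs ys \<Longrightarrow> length xs = length ys \<Longrightarrow> xs = ys"
  by (induction rule: zero_insertion.induct) (auto dest: zero_insertion_length)

lemma zero_insertion_refl: "zero_insertion xs xs"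
  by (induction xs) (auto intro: zero_insertion.intros)

lemma zero_insertion_trans:
  assumes "zero_insertion ys zs" "zero_insertion xs ys"
  shows "zero_insertion xs zs"
  using assms
proof (induction arbitrary: xs rule: zero_insertion.induct)
  case (keep ys zs y)
  from keep.prems show ?case
    by cases (auto intro: zero_insertion.intros keep.IH)
qed (auto intro: zero_insertion.intros)

text \<open>Together with the rule \<open>keep\<close> this compares words block by block: a run of zeros
  followed by the rest.\<close>

lemma zero_insertion_prefix:
  assumes "zero_insertion xs ys" "g \<le> h"
  shows "zero_insertion (replicate g 0 @ xs) (replicate h 0 @ ys)"
proof -
  obtain k where h: "h = k + g"
    using assms(2) by (metis le_add_diff_inverse2)
  have "zero_insertion (replicate g 0 @ xs) (replicate g 0 @ ys)"
    by (induction g) (auto intro: zero_insertion.intros assms)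
  then show ?thesis
    unfolding h replicate_add append_assoc
    by (induction k) (auto intro: zero_insertion.intros)
qed

text \<open>The map that records where the letters of the shorter word end up; all remaining
  positions of the longer word carry inserted zeros.\<close>

lemma zero_insertion_positions:
  assumes "zero_insertion xs ys"
  shows "\<exists>f. strict_mono_on {..<length xs} f \<and> f ` {..<length xs} \<subseteq> {..<length ys} \<and>
    (\<forall>i<length xs. ys ! f i = xs ! i) \<and> (\<forall>j<length ys. j \<notin> f ` {..<length xs} \<longrightarrow> ys ! j = 0)"
  using assms
proof (induction rule: zero_insertion.induct)
  case Nil
  then show ?case by auto
next
  case (keep xs ys x)
  then obtain f where f: "strict_mono_on {..<length xs} f" "f ` {..<length xs} \<subseteq> {..<length ys}"
    "\<forall>i<length xs. ys ! f i = xs ! i" "\<forall>j<length ys. j \<notin> f ` {..<length xs} \<longrightarrow> ys ! j = 0"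
    by blast
  define g where "g i = (case i of 0 \<Rightarrow> 0 | Suc k \<Rightarrow> Suc (f k))" for i
  have "strict_mono_on {..<length (x # xs)} g"
    using f(1) by (auto simp: strict_mono_on_def g_def split: nat.splits)
  moreover have "g ` {..<length (x # xs)} \<subseteq> {..<length (x # ys)}"
    using f(2) by (auto simp: g_def image_subset_iff split: nat.splits)
  moreover have "\<forall>i<length (x # xs). (x # ys) ! g i = (x # xs) ! i"
    using f(3) by (auto simp: g_def split: nat.splits)
  moreover have "(x # ys) ! j = 0"
    if "j < length (x # ys)" "j \<notin> g ` {..<length (x # xs)}" for j
  proof (cases j)
    case 0
    have "g 0 \<in> g ` {..<length (x # xs)}" by (rule imageI) simp
    then show ?thesis using 0 that by (simp add: g_def)
  next
    case (Suc k)
    have "k \<notin> f ` {..<length xs}"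
    proof
      assume "k \<in> f ` {..<length xs}"
      then obtain i where i: "i < length xs" "k = f i" by auto
      then have "g (Suc i) \<in> g ` {..<length (x # xs)}" by (intro imageI) simp
      then show False using i Suc that by (simp add: g_def)
    qed
    then show ?thesis using Suc that f(4) by auto
  qed
  ultimately show ?case by blast
next
  case (new xs ys)
  then obtain f where f: "strict_mono_on {..<length xs} f" "f ` {..<length xs} \<subseteq> {..<length ys}"
    "\<forall>i<length xs. ys ! f i = xs ! i" "\<forall>j<length ys. j \<notin> f ` {..<length xs} \<longrightarrow> ys ! j = 0"
    by blast
  have "strict_mono_on {..<length xs} (Suc \<circ> f)"
    using f(1) by (auto simp: strict_mono_on_def)
  moreover have "(Suc \<circ> f) ` {..<length xs} \<subseteq> {..<length (0 # ys)}"
    using f(2) by auto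
  moreover have "\<forall>i<length xs. (0 # ys) ! (Suc \<circ> f) i = xs ! i"
    using f(3) by auto
  moreover have "\<forall>j<length (0 # ys). j \<notin> (Suc \<circ> f) ` {..<length xs} \<longrightarrow> (0 # ys) ! j = 0"
    using f(4) by (auto simp: nth_Cons split: nat.splits)
  ultimately show ?case by blast
qed

text \<open>By the monotone subsequence theorem the only other possibility is a nonincreasing
  subsequence, which is constant from the point where it attains its minimum.\<close>

lemma nondecreasing_subsequence:
  fixes s :: "nat \<Rightarrow> nat"
  obtains r :: "nat \<Rightarrow> nat" where "strict_mono r" "\<And>i j. i \<le> j \<Longrightarrow> s (r i) \<le> s (r j)"
proof -
  obtain r :: "nat \<Rightarrow> nat" where r: "strict_mono r" "monoseq (\<lambda>n. s (r n))"
    using seq_monosub[of s] by auto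
  show thesis
  proof (cases "\<forall>i j. i \<le> j \<longrightarrow> s (r i) \<le> s (r j)")
    case True
    then show ?thesis using that r(1) by blast
  next
    case False
    then have dec: "s (r j) \<le> s (r i)" if "i \<le> j" for i j
      using r(2) that unfolding monoseq_def by blast
    obtain k where k: "\<And>i. s (r k) \<le> s (r i)"
      using ex_has_least_nat[of "\<lambda>_. True" 0 "\<lambda>i. s (r i)"] by auto
    have "strict_mono (\<lambda>i. r (k + i))"
      using r(1) by (auto simp: strict_mono_def)
    moreover have "s (r (k + i)) \<le> s (r (k + j))" for i j
      using dec[of k "k + i"] k[of "k + j"] by simp
    ultimately show ?thesis using that by blast
  qed
qed

lemma leading_zeros:
  fixes w :: "nat list"
  assumes "sum_list w \<noteq> 0"
  shows "\<exists>g a v. w = replicate g 0 @ a # v \<and> a \<noteq> 0"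
  using assms
proof (induction w)
  case (Cons x w)
  show ?case
  proof (cases "x = 0")
    case True
    then obtain g a v where "w = replicate g 0 @ a # v \<and> a \<noteq> 0"
      using Cons by auto
    then have "x # w = replicate (Suc g) 0 @ a # v \<and> a \<noteq> 0" using True by simp
    then show ?thesis by blast
  next
    case False
    then have "x # w = replicate 0 0 @ x # w \<and> x \<noteq> 0" by simp
    then show ?thesis by blast
  qed
qed simp

text \<open>The well-quasi-order, in the form that passes to products: every sequence has a subsequence
  that increases throughout.  A word of sum \<open>d > 0\<close> is a run of zeros, a letter \<open>a > 0\<close> and a word
  of the smaller sum \<open>d - a\<close>.  Pass to subsequences on which \<open>a\<close> is constant, then the
  remainders increase (by induction on the sum), and then the lengths of the initial runs increase.\<close>

lemma zero_insertion_subsequence: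
  fixes s :: "nat \<Rightarrow> nat list"
  assumes "\<And>i. sum_list (s i) = d"
  shows "\<exists>r :: nat \<Rightarrow> nat. strict_mono r \<and> (\<forall>i j. i \<le> j \<longrightarrow> zero_insertion (s (r i)) (s (r j)))"
  using assms
proof (induction d arbitrary: s rule: less_induct)
  case (less d)
  show ?case
  proof (cases "d = 0")
    case True
    have eq: "s i = replicate (length (s i)) 0" for i
      using less.prems[of i] True by (intro replicate_eqI) auto
    obtain r :: "nat \<Rightarrow> nat" where r: "strict_mono r" "\<And>i j. i \<le> j \<Longrightarrow> length (s (r i)) \<le> length (s (r j))"
      using nondecreasing_subsequence[of "\<lambda>i. length (s i)"] by blast
    have "zero_insertion (s (r i)) (s (r j))" if "i \<le> j" for i j
      using zero_insertion_prefix[OF zero_insertion.Nil r(2)[OF that]] eq by simp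
    then show ?thesis using r(1) by blast
  next
    case False
    then have "\<forall>i. \<exists>g a v. s i = replicate g 0 @ a # v \<and> a \<noteq> 0"
      using leading_zeros less.prems by metis
    then obtain g a v where s: "\<And>i. s i = replicate (g i) 0 @ a i # v i" "\<And>i. a i \<noteq> 0"
      by metis
    have sum: "a i + sum_list (v i) = d" for i
      using less.prems[of i] s(1)[of i] by (simp add: sum_list_replicate)
    have "a i \<le> d" for i
      using sum[of i] by simp
    then have "finite (range a)"
      by (intro finite_subset[of "range a" "{..d}"]) auto
    then obtain k where k: "infinite {i. a i = a k}"
      using pigeonhole_infinite[of UNIV a] by auto
    then obtain r1 :: "nat \<Rightarrow> nat" where r1: "strict_mono r1" "\<And>i. a (r1 i) = a k"
      using infinite_enumerate[OF k] by auto
    have less': "d - a k < d" using s(2)[of k] False by simp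
    have "sum_list (v (r1 i)) = d - a k" for i
      using sum[of "r1 i"] r1(2)[of i] by simp
    then obtain r2 :: "nat \<Rightarrow> nat" where r2: "strict_mono r2"
      "\<And>i j. i \<le> j \<Longrightarrow> zero_insertion (v (r1 (r2 i))) (v (r1 (r2 j)))"
      using less.IH[OF less', of "\<lambda>i. v (r1 i)"] by blast
    obtain r3 :: "nat \<Rightarrow> nat" where r3: "strict_mono r3"
      "\<And>i j. i \<le> j \<Longrightarrow> g (r1 (r2 (r3 i))) \<le> g (r1 (r2 (r3 j)))"
      using nondecreasing_subsequence[of "\<lambda>i. g (r1 (r2 i))"] by blast
    have "zero_insertion (s (r1 (r2 (r3 i)))) (s (r1 (r2 (r3 j))))" if "i \<le> j" for i j
    proof -
      have "r3 i \<le> r3 j" using r3(1) that by (simp add: strict_mono_less_eq)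
      then show ?thesis
        unfolding s(1) r1(2) using that
        by (intro zero_insertion_prefix zero_insertion.keep r2(2) r3(2))
    qed
    moreover have "strict_mono (\<lambda>i. r1 (r2 (r3 i)))"
      using r1(1) r2(1) r3(1) by (simp add: strict_mono_def)
    ultimately show ?thesis by blast
  qed
qed

text \<open>The minimal words form a basis, since insertion of zeros increases the length; infinitely
  many minimal words would contradict the well-quasi-order.\<close>

lemma zero_insertion_finite_basis:
  assumes "\<And>w. w \<in> A \<Longrightarrow> sum_list w = d"
  obtains F where "finite F" "F \<subseteq> A" "\<And>w. w \<in> A \<Longrightarrow> \<exists>v\<in>F. zero_insertion v w"
proof -
  define F where "F = {w \<in> A. \<forall>v\<in>A. zero_insertion v w \<longrightarrow> v = w}"
  have "finite F"
  proof (rule ccontr)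
    assume "infinite F"
    then obtain s :: "nat \<Rightarrow> nat list" where s: "inj s" "range s \<subseteq> F"
      using infinite_countable_subset by blast
    then have "sum_list (s i) = d" for i using assms by (auto simp: F_def)
    then obtain r :: "nat \<Rightarrow> nat" where r: "strict_mono r" "\<And>i j. i \<le> j \<Longrightarrow> zero_insertion (s (r i)) (s (r j))"
      using zero_insertion_subsequence[of s d] by blast
    have "zero_insertion (s (r 0)) (s (r 1))" using r(2) by simp
    then have "s (r 0) = s (r 1)" using s(2) unfolding F_def by blast
    then have "r 0 = r 1" using s(1) by (simp add: inj_eq)
    then show False using r(1) by (simp add: strict_mono_eq)
  qed
  moreover have "F \<subseteq> A" by (auto simp: F_def)
  moreover have "\<exists>v\<in>F. zero_insertion v w" if "w \<in> A" for w
    using that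
  proof (induction "length w" arbitrary: w rule: less_induct)
    case less
    show ?case
    proof (cases "w \<in> F")
      case True
      then show ?thesis using zero_insertion_refl by blast
    next
      case False
      then obtain v where v: "v \<in> A" "zero_insertion v w" "v \<noteq> w"
        using less.prems by (auto simp: F_def)
      then have "length v < length w"
        using zero_insertion_length[OF v(2)] zero_insertion_eq[OF v(2)] by linarith
      then show ?thesis using less.hyps v zero_insertion_trans by blast
    qed
  qed
  ultimately show thesis using that by blast
qed

section \<open>Monomials under order-preserving injections\<close>

definition monomials :: "nat \<Rightarrow> nat \<Rightarrow> monomial set" where
  "monomials n d = {u. Poly_Mapping.keys u \<subseteq> {1..n} \<and> mon_degree u = d}"

text \<open>The exponent vector composed with \<open>f\<close>.  It is the pullback of the monomial \<open>v\<close> when all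
  variables of \<open>v\<close> lie in the image of \<open>f\<close>; otherwise the pullback of \<open>v\<close> is 0.\<close>

definition pull_mon :: "nat \<Rightarrow> (nat \<Rightarrow> nat) \<Rightarrow> monomial \<Rightarrow> monomial" where
  "pull_mon m f v = Abs_poly_mapping (\<lambda>i. if i \<in> {1..m} then Poly_Mapping.lookup v (f i) else 0)"

lemma lookup_pull_mon:
  "Poly_Mapping.lookup (pull_mon m f v) i = (if i \<in> {1..m} then Poly_Mapping.lookup v (f i) else 0)"
  unfolding pull_mon_def by (subst lookup_Abs_poly_mapping) auto

lemma keys_pull_mon: "Poly_Mapping.keys (pull_mon m f v) = {i\<in>{1..m}. f i \<in> Poly_Mapping.keys v}"
  by (auto simp: in_keys_iff lookup_pull_mon split: if_splits)

lemma mon_degree_superset: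
  assumes "finite A" "Poly_Mapping.keys u \<subseteq> A"
  shows "mon_degree u = (\<Sum>i\<in>A. Poly_Mapping.lookup u i)"
  unfolding mon_degree_def by (intro sum.mono_neutral_left assms) (auto simp: in_keys_iff)

lemma mon_degree_pull_mon:
  assumes "inj_on f {1..m}" "Poly_Mapping.keys v \<subseteq> f ` {1..m}"
  shows "mon_degree (pull_mon m f v) = mon_degree v"
proof -
  have "mon_degree (pull_mon m f v) = (\<Sum>i\<in>{1..m}. Poly_Mapping.lookup v (f i))"
    by (subst mon_degree_superset[of "{1..m}"]) (auto simp: keys_pull_mon lookup_pull_mon)
  also have "\<dots> = (\<Sum>i\<in>f ` {1..m}. Poly_Mapping.lookup v i)"
    using assms(1) by (simp add: sum.reindex)
  also have "\<dots> = mon_degree v"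
    by (rule mon_degree_superset[symmetric]) (use assms in auto)
  finally show ?thesis .
qed

lemma pull_mon_mem_monomials:
  assumes "inj_on f {1..m}" "Poly_Mapping.keys v \<subseteq> f ` {1..m}" "v \<in> monomials n d"
  shows "pull_mon m f v \<in> monomials m d"
  using assms mon_degree_pull_mon[OF assms(1,2)] by (auto simp: monomials_def keys_pull_mon)

text \<open>Type \<^typ>\<open>monomial\<close> carries the lexicographic order, in which the first differing exponent
  decides.  As \<open>f\<close> preserves the order of the variables, and the first position where \<open>u\<close> falls
  below \<open>v\<close> is a variable of \<open>v\<close>, hence in the image of \<open>f\<close>, the comparison survives.\<close>

lemma pull_mon_less:
  assumes "strict_mono_on {1..m} f" "Poly_Mapping.keys v \<subseteq> f ` {1..m}" "u < v"
  shows "pull_mon m f u < pull_mon m f v"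
proof -
  obtain k where k: "Poly_Mapping.lookup u k < Poly_Mapping.lookup v k"
    "\<And>j. j < k \<Longrightarrow> Poly_Mapping.lookup u j = Poly_Mapping.lookup v j"
    using assms(3) by (auto simp: less_poly_mapping.rep_eq less_fun_def)
  have "k \<in> Poly_Mapping.keys v" using k(1) by (simp add: in_keys_iff)
  then obtain i where i: "i \<in> {1..m}" "k = f i" using assms(2) by auto
  have "Poly_Mapping.lookup u (f j) = Poly_Mapping.lookup v (f j)" if "j \<in> {1..m}" "j < i" for j
    using assms(1) that i by (intro k(2)) (auto simp: strict_mono_on_def)
  then show ?thesis
    unfolding less_poly_mapping.rep_eq less_fun_def
    using k(1) i by (intro exI[of _ i]) (auto simp: lookup_pull_mon)
qed

definition exponent_word :: "nat \<Rightarrow> monomial \<Rightarrow> nat list" where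
  "exponent_word n u = map (\<lambda>i. Poly_Mapping.lookup u (Suc i)) [0..<n]"

lemma length_exponent_word [simp]: "length (exponent_word n u) = n"
  by (simp add: exponent_word_def)

lemma nth_exponent_word [simp]: "i < n \<Longrightarrow> exponent_word n u ! i = Poly_Mapping.lookup u (Suc i)"
  by (simp add: exponent_word_def)

lemma sum_list_exponent_word:
  assumes "u \<in> monomials n d"
  shows "sum_list (exponent_word n u) = d"
proof -
  have "sum_list (exponent_word n u) = (\<Sum>i\<in>{0..<n}. Poly_Mapping.lookup u (Suc i))"
    unfolding exponent_word_def by (simp add: interv_sum_list_conv_sum_set_nat)
  also have "\<dots> = (\<Sum>i\<in>{1..n}. Poly_Mapping.lookup u i)"
    by (simp add: sum.shift_bounds_Suc_ivl[symmetric] atLeastLessThanSuc_atLeastAtMost)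
  also have "\<dots> = mon_degree u"
    using assms by (intro mon_degree_superset[symmetric]) (auto simp: monomials_def)
  finally show ?thesis using assms by (simp add: monomials_def)
qed

lemma finite_monomials: "finite (monomials n d)"
proof (rule inj_on_finite)
  show "inj_on (exponent_word n) (monomials n d)"
  proof (rule inj_onI, rule poly_mapping_eqI)
    fix u v i assume uv: "u \<in> monomials n d" "v \<in> monomials n d" "exponent_word n u = exponent_word n v"
    show "Poly_Mapping.lookup u i = Poly_Mapping.lookup v i"
    proof (cases "i \<in> {1..n}")
      case True
      then obtain j where "i = Suc j" "j < n" by (cases i) auto
      then show ?thesis using uv(3) nth_exponent_word by metis
    next
      case False
      then have "i \<notin> Poly_Mapping.keys u" "i \<notin> Poly_Mapping.keys v"
        using uv by (auto simp: monomials_def)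
      then show ?thesis by (simp add: in_keys_iff)
    qed
  qed
  show "exponent_word n ` monomials n d \<subseteq> {w. set w \<subseteq> {..d} \<and> length w = n}"
  proof (intro image_subsetI CollectI conjI subsetI)
    fix u x assume "u \<in> monomials n d" "x \<in> set (exponent_word n u)"
    then show "x \<in> {..d}"
      using member_le_sum_list[of x "exponent_word n u"] sum_list_exponent_word[of u n d] by simp
  qed simp
  show "finite {w. set w \<subseteq> {..d} \<and> length w = n}"
    by (rule finite_lists_length_eq) simp
qed

text \<open>Translates insertion of zeros back into FI: positions of words are counted from 0, variables
  from 1, whence the shifts by one.\<close>

lemma zero_insertion_injection:
  assumes "zero_insertion (exponent_word m u) (exponent_word n v)"
    and "u \<in> monomials m d" "v \<in> monomials n d"
  obtains f where "f \<in> fi_hom m n" "strict_mono_on {1..m} f" "Poly_Mapping.keys v \<subseteq> f ` {1..m}"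
    "pull_mon m f v = u"
proof -
  obtain h where h: "strict_mono_on {..<m} h" "h ` {..<m} \<subseteq> {..<n}"
    "\<And>i. i < m \<Longrightarrow> exponent_word n v ! h i = exponent_word m u ! i"
    "\<And>j. j < n \<Longrightarrow> j \<notin> h ` {..<m} \<Longrightarrow> exponent_word n v ! j = 0"
    using zero_insertion_positions[OF assms(1)] by auto
  define f where "f = (\<lambda>i\<in>{1..m}. Suc (h (i - 1)))"
  have mono: "strict_mono_on {1..m} f"
    unfolding strict_mono_on_def
  proof (intro allI impI)
    fix r s assume "r \<in> {1..m} \<and> s \<in> {1..m} \<and> r < s"
    then show "f r < f s"
      using strict_mono_onD[OF h(1), of "r - 1" "s - 1"] by (auto simp: f_def)
  qed
  moreover have "f \<in> fi_hom m n"
  proof -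
    have "h (i - 1) < n" if "i \<in> {1..m}" for i
      using h(2) that by (auto simp: image_subset_iff)
    then show ?thesis
      unfolding fi_hom_def using strict_mono_on_imp_inj_on[OF mono] by (auto simp: f_def Suc_le_eq)
  qed
  moreover have keys: "Poly_Mapping.keys v \<subseteq> f ` {1..m}"
  proof
    fix k assume k: "k \<in> Poly_Mapping.keys v"
    then obtain j where j: "k = Suc j" "j < n"
      using assms(3) by (cases k) (auto simp: monomials_def)
    then have "exponent_word n v ! j \<noteq> 0" using k by (simp add: in_keys_iff)
    then have "j \<in> h ` {..<m}" using h(4)[OF j(2)] by argo
    then obtain i where i: "i < m" "j = h i" by auto
    then have "k = f (Suc i)" using j by (simp add: f_def)
    then show "k \<in> f ` {1..m}" using i by auto
  qed
  moreover have "pull_mon m f v = u"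
  proof (rule poly_mapping_eqI)
    fix i
    show "Poly_Mapping.lookup (pull_mon m f v) i = Poly_Mapping.lookup u i"
    proof (cases "i \<in> {1..m}")
      case True
      then obtain j where j: "i = Suc j" "j < m" by (cases i) auto
      then have "h j < n" using h(2) by auto
      then show ?thesis using h(3)[OF j(2)] j by (simp add: lookup_pull_mon f_def)
    next
      case False
      then have "i \<notin> Poly_Mapping.keys u" using assms(2) by (auto simp: monomials_def)
      then show ?thesis unfolding lookup_pull_mon if_not_P[OF False] by (simp add: in_keys_iff)
    qed
  qed
  ultimately show thesis using that by blast
qed

section \<open>A Noetherian theorem for FI-modules\<close>

lemma complex_field_simps [simp]:
  "carrier complex_field = UNIV" "\<one>\<^bsub>complex_field\<^esub> = 1" "\<zero>\<^bsub>complex_field\<^esub> = 0"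
  "a \<oplus>\<^bsub>complex_field\<^esub> b = a + b" "a \<otimes>\<^bsub>complex_field\<^esub> b = a * b"
  by (simp_all add: complex_field_def)

lemma submodule_cancel:
  assumes "module complex_field V" "submodule W complex_field V"
    and "x \<in> carrier V" "y \<in> W" "x \<oplus>\<^bsub>V\<^esub> c \<odot>\<^bsub>V\<^esub> y \<in> W"
  shows "x \<in> W"
proof -
  interpret module complex_field V by fact
  note W = submoduleE[OF assms(2)]
  have y: "y \<in> carrier V" using W(1) assms(4) by auto
  have "(x \<oplus>\<^bsub>V\<^esub> c \<odot>\<^bsub>V\<^esub> y) \<oplus>\<^bsub>V\<^esub> (\<ominus>\<^bsub>V\<^esub> (c \<odot>\<^bsub>V\<^esub> y)) \<in> W"
    using assms W by simp
  moreover have "(x \<oplus>\<^bsub>V\<^esub> c \<odot>\<^bsub>V\<^esub> y) \<oplus>\<^bsub>V\<^esub> (\<ominus>\<^bsub>V\<^esub> (c \<odot>\<^bsub>V\<^esub> y)) = x"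
    using assms(3) y by (simp add: M.a_assoc M.r_neg)
  ultimately show ?thesis by simp
qed

text \<open>The function \<open>\<kappa> n x\<close> gives the coefficients of \<open>x\<close> on the monomials of degree \<open>d\<close>; the last
  assumption says that \<open>\<kappa>\<close> turns the action into pullback of functions, so together with
  faithfulness \<open>V\<close> is an FI-submodule of the dual of the degree \<open>d\<close> part of the polynomial rings.  The generators are
  elements whose leading monomials form a finite basis of all leading monomials.\<close>

theorem finitely_generated_by_leading_monomials:
  fixes \<kappa> :: "nat \<Rightarrow> 'a \<Rightarrow> monomial \<Rightarrow> complex"
  assumes fi: "fi_module V act"
    and add: "\<And>n x y u. 1 \<le> n \<Longrightarrow> x \<in> carrier (V n) \<Longrightarrow> y \<in> carrier (V n) \<Longrightarrow>
      u \<in> monomials n d \<Longrightarrow> \<kappa> n (x \<oplus>\<^bsub>V n\<^esub> y) u = \<kappa> n x u + \<kappa> n y u"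
    and smult: "\<And>n c x u. 1 \<le> n \<Longrightarrow> x \<in> carrier (V n) \<Longrightarrow>
      u \<in> monomials n d \<Longrightarrow> \<kappa> n (c \<odot>\<^bsub>V n\<^esub> x) u = c * \<kappa> n x u"
    and faithful: "\<And>n x. 1 \<le> n \<Longrightarrow> x \<in> carrier (V n) \<Longrightarrow> (\<And>u. u \<in> monomials n d \<Longrightarrow> \<kappa> n x u = 0) \<Longrightarrow>
      x = \<zero>\<^bsub>V n\<^esub>"
    and act: "\<And>m n f x v. 1 \<le> m \<Longrightarrow> 1 \<le> n \<Longrightarrow> f \<in> fi_hom m n \<Longrightarrow> x \<in> carrier (V m) \<Longrightarrow>
      v \<in> monomials n d \<Longrightarrow> \<kappa> n (act m n f x) v =
        (if Poly_Mapping.keys v \<subseteq> f ` {1..m} then \<kappa> m x (pull_mon m f v) else 0)"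
  shows "finitely_generated_fi_module V act"
proof -
  interpret fi_module V act by (rule fi)
  define leading where "leading n x u \<longleftrightarrow> u \<in> monomials n d \<and> \<kappa> n x u \<noteq> 0 \<and>
    (\<forall>v\<in>monomials n d. u < v \<longrightarrow> \<kappa> n x v = 0)" for n x u
  define A where "A = {exponent_word n u |n x u. 1 \<le> n \<and> x \<in> carrier (V n) \<and> leading n x u}"
  have sum: "sum_list w = d" if "w \<in> A" for w
    using that sum_list_exponent_word by (auto simp: A_def leading_def)
  obtain F where F: "finite F" "F \<subseteq> A" "\<And>w. w \<in> A \<Longrightarrow> \<exists>v\<in>F. zero_insertion v w"
    by (rule zero_insertion_finite_basis[OF sum]) (assumption, rule that)
  have "\<forall>w\<in>F. \<exists>n x u. w = exponent_word n u \<and> 1 \<le> n \<and> x \<in> carrier (V n) \<and> leading n x u"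
    using F(2) by (auto simp: A_def)
  then obtain N X U where NXU: "\<And>w. w \<in> F \<Longrightarrow> w = exponent_word (N w) (U w) \<and> 1 \<le> N w \<and>
      X w \<in> carrier (V (N w)) \<and> leading (N w) (X w) (U w)"
    by metis
  define S where "S = (\<lambda>w. (N w, X w)) ` F"
  have "W n = carrier (V n)"
    if W: "sub_fi_module V act W" and S: "\<forall>(n, x)\<in>S. x \<in> W n" and n: "1 \<le> n" for W n
  proof
    have sub: "submodule (W n) complex_field (V n)"
      using W n by (auto simp: sub_fi_module_def)
    interpret module complex_field "V n" by (rule vector_space[OF n])
    show "W n \<subseteq> carrier (V n)" using submoduleE(1)[OF sub] .
    have zero: "\<zero>\<^bsub>V n\<^esub> \<in> W n"
      using subgroup.one_closed[OF submodule.axioms(1)[OF sub]] by simp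
    \<comment> \<open>Division with remainder.  The measure counts the monomials up to the leading one.\<close>
    have "x \<in> W n" if "x \<in> carrier (V n)"
      "card {u\<in>monomials n d. \<exists>v\<in>monomials n d. \<kappa> n x v \<noteq> 0 \<and> u \<le> v} = k" for x k
      using that
    proof (induction k arbitrary: x rule: less_induct)
      case (less k)
      define supp where "supp = {u\<in>monomials n d. \<kappa> n x u \<noteq> 0}"
      have fin: "finite supp" using finite_monomials by (simp add: supp_def)
      show ?case
      proof (cases "supp = {}")
        case True
        then have "x = \<zero>\<^bsub>V n\<^esub>" using faithful[OF n less.prems(1)] by (auto simp: supp_def)
        then show ?thesis using zero by simp
      next
        case False
        define u where "u = Max supp"
        have u: "u \<in> supp" unfolding u_def using fin False by (rule Max_in)
        have "v \<le> u" if "v \<in> supp" for v unfolding u_def using fin that by (rule Max_ge)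
        then have lead: "leading n x u"
          using u by (auto simp: leading_def supp_def not_le[symmetric])
        then have "exponent_word n u \<in> A" using n less.prems(1) by (auto simp: A_def)
        then obtain w where w: "w \<in> F" "zero_insertion w (exponent_word n u)" using F(3) by blast
        define m where "m = N w"
        note nxu = NXU[OF w(1), folded m_def]
        have lead': "leading m (X w) (U w)" using nxu by simp
        have "zero_insertion (exponent_word m (U w)) (exponent_word n u)" using nxu w by simp
        then obtain f where f: "f \<in> fi_hom m n" "strict_mono_on {1..m} f"
          "Poly_Mapping.keys u \<subseteq> f ` {1..m}" "pull_mon m f u = U w"
          using lead lead' by (auto simp: leading_def elim: zero_insertion_injection)
        define y where "y = act m n f (X w)"
        have m: "1 \<le> m" and Xw: "X w \<in> carrier (V m)" using nxu by auto
        have "X w \<in> W m" using S w(1) by (auto simp: S_def m_def)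
        then have yW: "y \<in> W n"
          using W m n f(1) unfolding sub_fi_module_def y_def by blast
        have y: "y \<in> carrier (V n)"
          using act_hom[OF m n f(1)] Xw by (auto simp: lin_hom_def y_def)
        have \<kappa>y: "\<kappa> n y v = (if Poly_Mapping.keys v \<subseteq> f ` {1..m} then \<kappa> m (X w) (pull_mon m f v) else 0)"
          if "v \<in> monomials n d" for v
          unfolding y_def by (rule act[OF m n f(1) Xw that])
        have yu: "\<kappa> n y u \<noteq> 0"
          using \<kappa>y[of u] lead lead' f(3,4) by (simp add: leading_def)
        have y_above: "\<kappa> n y v = 0" if "v \<in> monomials n d" "u < v" for v
        proof (cases "Poly_Mapping.keys v \<subseteq> f ` {1..m}")
          case True
          have "U w < pull_mon m f v" using pull_mon_less[OF f(2) True that(2)] f(4) by simp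
          moreover have "pull_mon m f v \<in> monomials m d"
            using pull_mon_mem_monomials[OF strict_mono_on_imp_inj_on[OF f(2)] True that(1)] .
          ultimately show ?thesis using \<kappa>y[OF that(1)] lead' by (simp add: leading_def)
        qed (use \<kappa>y[OF that(1)] in simp)
        \<comment> \<open>Adding \<open>c\<close> times \<open>y\<close> cancels the leading term of \<open>x\<close>.\<close>
        define c where "c = - \<kappa> n x u / \<kappa> n y u"
        define z where "z = x \<oplus>\<^bsub>V n\<^esub> c \<odot>\<^bsub>V n\<^esub> y"
        have cy: "c \<odot>\<^bsub>V n\<^esub> y \<in> carrier (V n)" using y by simp
        have z: "z \<in> carrier (V n)" unfolding z_def using less.prems(1) cy by simp
        have \<kappa>z: "\<kappa> n z v = \<kappa> n x v + c * \<kappa> n y v" if "v \<in> monomials n d" for v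
          unfolding z_def add[OF n less.prems(1) cy that] smult[OF n y that] ..
        have z_below: "v < u" if "v \<in> monomials n d" "\<kappa> n z v \<noteq> 0" for v
        proof (rule ccontr)
          assume "\<not> v < u"
          then consider "v = u" | "u < v" by fastforce
          then have "\<kappa> n z v = 0"
          proof cases
            case 1
            then show ?thesis using \<kappa>z[OF that(1)] yu by (simp add: c_def)
          next
            case 2
            then show ?thesis using \<kappa>z[OF that(1)] y_above[OF that(1)] lead that(1)
              by (simp add: leading_def)
          qed
          then show False using that by simp
        qed
        have "{v\<in>monomials n d. \<exists>v'\<in>monomials n d. \<kappa> n z v' \<noteq> 0 \<and> v \<le> v'} \<subseteq>
          {v\<in>monomials n d. \<exists>v'\<in>monomials n d. \<kappa> n x v' \<noteq> 0 \<and> v \<le> v'} - {u}"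
          using z_below u by (fastforce simp: supp_def)
        moreover have "u \<in> {v\<in>monomials n d. \<exists>v'\<in>monomials n d. \<kappa> n x v' \<noteq> 0 \<and> v \<le> v'}"
          using u by (auto simp: supp_def)
        ultimately have "{v\<in>monomials n d. \<exists>v'\<in>monomials n d. \<kappa> n z v' \<noteq> 0 \<and> v \<le> v'} \<subset>
          {v\<in>monomials n d. \<exists>v'\<in>monomials n d. \<kappa> n x v' \<noteq> 0 \<and> v \<le> v'}"
          by blast
        then have "card {v\<in>monomials n d. \<exists>v'\<in>monomials n d. \<kappa> n z v' \<noteq> 0 \<and> v \<le> v'} < k"
          unfolding less.prems(2)[symmetric] using finite_monomials
          by (intro psubset_card_mono) simp_all
        then have "z \<in> W n" using less.IH z by blast
        then show ?thesis
          using submodule_cancel[OF vector_space[OF n] sub less.prems(1) yW] by (simp add: z_def)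
      qed
    qed
    then show "carrier (V n) \<subseteq> W n" by blast
  qed
  moreover have "finite S" using F(1) by (simp add: S_def)
  moreover have "S \<subseteq> Sigma {1..} (\<lambda>n. carrier (V n))" using NXU by (auto simp: S_def)
  ultimately show ?thesis unfolding finitely_generated_fi_module_def using fi by blast
qed

section \<open>Graded vector spaces\<close>

lemma (in abelian_monoid) finsum_support:
  assumes "finite D" "{d. c d \<noteq> \<zero>} \<subseteq> D" "\<And>d. c d \<in> carrier G"
  shows "(\<Oplus>d\<in>{d. c d \<noteq> \<zero>}. c d) = (\<Oplus>d\<in>D. c d)"
  by (rule add.finprod_mono_neutral_cong_left) (use assms in auto)

lemma (in module) submodule_zero:
  assumes "submodule H R M"
  shows "\<zero>\<^bsub>M\<^esub> \<in> H"
  using subgroup.one_closed[OF submodule.axioms(1)[OF assms]] by simp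

lemma cring_complex_field: "cring complex_field"
  by (rule domain.axioms(1)[OF field.axioms(1)[OF field_complex_field]])

text \<open>A grading can be certified by its projections: applying the projections to any
  decomposition of \<open>x\<close> recovers its terms, which gives uniqueness.\<close>

lemma graded_vector_spaceI:
  fixes V :: "(complex, 'a) module" (structure)
  assumes V: "module complex_field V"
    and G: "\<And>d. submodule (G d) complex_field V"
    and mem: "\<And>d x. x \<in> carrier V \<Longrightarrow> \<pi> d x \<in> G d"
    and add: "\<And>d x y. x \<in> carrier V \<Longrightarrow> y \<in> carrier V \<Longrightarrow> \<pi> d (x \<oplus> y) = \<pi> d x \<oplus> \<pi> d y"
    and same: "\<And>d x. x \<in> G d \<Longrightarrow> \<pi> d x = x"
    and other: "\<And>d e x. x \<in> G e \<Longrightarrow> e \<noteq> d \<Longrightarrow> \<pi> d x = \<zero>"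
    and fin: "\<And>x. x \<in> carrier V \<Longrightarrow> finite {d. \<pi> d x \<noteq> \<zero>}"
    and total: "\<And>x. x \<in> carrier V \<Longrightarrow> x = (\<Oplus>d\<in>{d. \<pi> d x \<noteq> \<zero>}. \<pi> d x)"
  shows "graded_vector_space V G"
proof (rule graded_vector_space.intro)
  interpret V: module complex_field V by (rule V)
  show "module complex_field V" by (rule V)
  show "submodule (G d) complex_field V" for d by (rule G)
  have sub: "G d \<subseteq> carrier V" for d by (rule V.submoduleE(1)[OF G])
  have zero: "\<pi> d \<zero> = \<zero>" for d
    using other[of "\<zero>" "Suc d" d] V.submodule_zero[OF G] by simp
  have sum: "\<pi> e (\<Oplus>d\<in>D. c d) = (\<Oplus>d\<in>D. \<pi> e (c d))"
    if "finite D" "\<And>d. c d \<in> carrier V" for D :: "nat set" and c e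
    using that(1)
  proof (induction D rule: finite_induct)
    case empty
    then show ?case by (simp add: zero)
  next
    case (insert d D)
    have "\<pi> e (c d) \<in> carrier V" for d using mem[OF that(2)] sub by blast
    with insert show ?case using that(2) by (simp add: add)
  qed
  fix x assume x: "x \<in> carrier V"
  show "\<exists>!c. (\<forall>d. c d \<in> G d) \<and> finite {d. c d \<noteq> \<zero>} \<and> x = (\<Oplus>d\<in>{d. c d \<noteq> \<zero>}. c d)"
  proof (rule ex1I[of _ "\<lambda>d. \<pi> d x"])
    show "(\<forall>d. \<pi> d x \<in> G d) \<and> finite {d. \<pi> d x \<noteq> \<zero>} \<and> x = (\<Oplus>d\<in>{d. \<pi> d x \<noteq> \<zero>}. \<pi> d x)"
      using mem fin total x by simp
    fix c assume c: "(\<forall>d. c d \<in> G d) \<and> finite {d. c d \<noteq> \<zero>} \<and> x = (\<Oplus>d\<in>{d. c d \<noteq> \<zero>}. c d)"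
    show "c = (\<lambda>d. \<pi> d x)"
    proof
      fix e
      define D where "D = insert e {d. c d \<noteq> \<zero>}"
      have D: "finite D" "e \<in> D" using c by (auto simp: D_def)
      have cV: "c d \<in> carrier V" for d using c sub by blast
      have "x = (\<Oplus>d\<in>D. c d)"
        using c V.finsum_support[OF D(1), of c] cV by (auto simp: D_def)
      then have "\<pi> e x = (\<Oplus>d\<in>D. \<pi> e (c d))" using sum[OF D(1)] cV by simp
      also have "(\<lambda>d. \<pi> e (c d)) = (\<lambda>d. if e = d then c d else \<zero>)"
        using c same other by (metis (full_types))
      also have "(\<Oplus>d\<in>D. if e = d then c d else \<zero>) = c e" using D cV by (intro V.add.finprod_singleton) auto
      finally show "c e = \<pi> e x" by simp
    qed
  qed
qed

definition component :: "(complex, 'a) module \<Rightarrow> (nat \<Rightarrow> 'a set) \<Rightarrow> nat \<Rightarrow> 'a \<Rightarrow> 'a" where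
  "component V G d x = (THE c. (\<forall>d. c d \<in> G d) \<and> finite {d. c d \<noteq> \<zero>\<^bsub>V\<^esub>} \<and>
        x = (\<Oplus>\<^bsub>V\<^esub>d\<in>{d. c d \<noteq> \<zero>\<^bsub>V\<^esub>}. c d)) d"

context graded_vector_space
begin

interpretation V: module complex_field V by (rule vector_space)

lemma graded_part_subset: "G d \<subseteq> carrier V"
  by (rule V.submoduleE(1)[OF graded_part])

lemma component:
  assumes "x \<in> carrier V"
  shows "component V G d x \<in> G d" "finite {d. component V G d x \<noteq> \<zero>\<^bsub>V\<^esub>}"
    "x = (\<Oplus>\<^bsub>V\<^esub>d\<in>{d. component V G d x \<noteq> \<zero>\<^bsub>V\<^esub>}. component V G d x)"
  using theI'[OF direct_sum[OF assms]] unfolding component_def by blast+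

text \<open>Decompositions indexed by any finite superset of the support are admitted, so that those of two
  elements can be added over a common index set.\<close>

lemma component_unique:
  assumes "finite D" "x = (\<Oplus>\<^bsub>V\<^esub>d\<in>D. c d)" "\<And>d. c d \<in> G d" "\<And>d. d \<notin> D \<Longrightarrow> c d = \<zero>\<^bsub>V\<^esub>"
  shows "component V G d x = c d"
proof -
  have c: "c d \<in> carrier V" for d using assms(3) graded_part_subset by blast
  have sub: "{d. c d \<noteq> \<zero>\<^bsub>V\<^esub>} \<subseteq> D" using assms(4) by auto
  have "x = (\<Oplus>\<^bsub>V\<^esub>d\<in>{d. c d \<noteq> \<zero>\<^bsub>V\<^esub>}. c d)"
    using assms(2) V.finsum_support[OF assms(1) sub] c by simp
  moreover have "x \<in> carrier V" unfolding assms(2) using c by (intro V.finsum_closed) auto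
  ultimately show ?thesis
    unfolding component_def using assms(3) finite_subset[OF sub assms(1)]
    by (subst the1_equality[OF direct_sum]) auto
qed

lemma component_sum:
  assumes "x \<in> carrier V" "finite D" "{d. component V G d x \<noteq> \<zero>\<^bsub>V\<^esub>} \<subseteq> D"
  shows "x = (\<Oplus>\<^bsub>V\<^esub>d\<in>D. component V G d x)"
  using component(3)[OF assms(1)] V.finsum_support[OF assms(2,3)] component(1)[OF assms(1)]
    graded_part_subset by auto

lemma component_add:
  assumes "x \<in> carrier V" "y \<in> carrier V"
  shows "component V G d (x \<oplus>\<^bsub>V\<^esub> y) = component V G d x \<oplus>\<^bsub>V\<^esub> component V G d y"
proof -
  define D where "D = {d. component V G d x \<noteq> \<zero>\<^bsub>V\<^esub>} \<union> {d. component V G d y \<noteq> \<zero>\<^bsub>V\<^esub>}"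
  have D: "finite D" using component(2) assms by (simp add: D_def)
  have xy: "component V G d x \<in> carrier V" "component V G d y \<in> carrier V" for d
    using component(1) assms graded_part_subset by blast+
  show ?thesis
  proof (rule component_unique[OF D])
    show "x \<oplus>\<^bsub>V\<^esub> y = (\<Oplus>\<^bsub>V\<^esub>d\<in>D. component V G d x \<oplus>\<^bsub>V\<^esub> component V G d y)"
      using component_sum[OF assms(1) D] component_sum[OF assms(2) D] xy
      by (subst V.finsum_addf) (auto simp: D_def)
    show "component V G d x \<oplus>\<^bsub>V\<^esub> component V G d y \<in> G d" for d
      using component(1) assms V.submoduleE(5)[OF graded_part] by blast
  qed (auto simp: D_def)
qed

lemma component_smult:
  assumes "x \<in> carrier V"
  shows "component V G d (a \<odot>\<^bsub>V\<^esub> x) = a \<odot>\<^bsub>V\<^esub> component V G d x"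
proof -
  define D where "D = {d. component V G d x \<noteq> \<zero>\<^bsub>V\<^esub>}"
  have D: "finite D" using component(2) assms by (simp add: D_def)
  have x: "component V G d x \<in> carrier V" for d
    using component(1) assms graded_part_subset by blast
  show ?thesis
  proof (rule component_unique[OF D])
    show "a \<odot>\<^bsub>V\<^esub> x = (\<Oplus>\<^bsub>V\<^esub>d\<in>D. a \<odot>\<^bsub>V\<^esub> component V G d x)"
      using component_sum[OF assms(1) D] x V.finsum_smult_ldistr[OF D, of a "\<lambda>d. component V G d x"]
      by (auto simp: D_def)
    show "a \<odot>\<^bsub>V\<^esub> component V G d x \<in> G d" for d
      using component(1) assms V.submoduleE(4)[OF graded_part] by simp
  qed (auto simp: D_def)
qed

lemma component_same:
  assumes "x \<in> G d"
  shows "component V G e x = (if e = d then x else \<zero>\<^bsub>V\<^esub>)"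
proof (rule component_unique[of "{d}"])
  have "x \<in> carrier V" using assms graded_part_subset by blast
  then show "x = (\<Oplus>\<^bsub>V\<^esub>e\<in>{d}. if e = d then x else \<zero>\<^bsub>V\<^esub>)" by simp
qed (use assms V.submodule_zero[OF graded_part] in auto)

end

section \<open>Graded duals\<close>

lemma graded_dual_simps [simp]:
  "\<zero>\<^bsub>graded_dual V G\<^esub> = (\<lambda>x\<in>carrier V. 0)"
  "\<phi> \<oplus>\<^bsub>graded_dual V G\<^esub> \<psi> = (\<lambda>x\<in>carrier V. \<phi> x + \<psi> x)"
  "c \<odot>\<^bsub>graded_dual V G\<^esub> \<phi> = (\<lambda>x\<in>carrier V. c * \<phi> x)"
  by (simp_all add: graded_dual_def)

lemma complex_field_smult [simp]: "c \<odot>\<^bsub>complex_field\<^esub> x = c * x"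
  by (simp add: complex_field_def)

lemma graded_dual_memD:
  assumes "\<phi> \<in> carrier (graded_dual V G)"
  shows "\<phi> \<in> extensional (carrier V)"
    "\<And>x y. x \<in> carrier V \<Longrightarrow> y \<in> carrier V \<Longrightarrow> \<phi> (x \<oplus>\<^bsub>V\<^esub> y) = \<phi> x + \<phi> y"
    "\<And>c x. x \<in> carrier V \<Longrightarrow> \<phi> (c \<odot>\<^bsub>V\<^esub> x) = c * \<phi> x"
    "finite {d. \<exists>x\<in>G d. \<phi> x \<noteq> 0}"
  using assms by (auto simp: graded_dual_def lin_hom_def)

lemma graded_dual_memI:
  assumes "\<phi> \<in> extensional (carrier V)"
    "\<And>x y. x \<in> carrier V \<Longrightarrow> y \<in> carrier V \<Longrightarrow> \<phi> (x \<oplus>\<^bsub>V\<^esub> y) = \<phi> x + \<phi> y"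
    "\<And>c x. x \<in> carrier V \<Longrightarrow> \<phi> (c \<odot>\<^bsub>V\<^esub> x) = c * \<phi> x"
    "finite {d. \<exists>x\<in>G d. \<phi> x \<noteq> 0}"
  shows "\<phi> \<in> carrier (graded_dual V G)"
  using assms by (auto simp: graded_dual_def lin_hom_def)

context graded_vector_space
begin

interpretation V: module complex_field V by (rule vector_space)

lemma graded_dual_zero: "\<phi> \<in> carrier (graded_dual V G) \<Longrightarrow> \<phi> \<zero>\<^bsub>V\<^esub> = 0"
  using graded_dual_memD(3)[of \<phi> V G "\<zero>\<^bsub>V\<^esub>" 0] by simp

lemma graded_dual_add_closed:
  assumes "\<phi> \<in> carrier (graded_dual V G)" "\<psi> \<in> carrier (graded_dual V G)"
  shows "(\<lambda>x\<in>carrier V. \<phi> x + \<psi> x) \<in> carrier (graded_dual V G)"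
proof (rule graded_dual_memI)
  have "{d. \<exists>x\<in>G d. (\<lambda>x\<in>carrier V. \<phi> x + \<psi> x) x \<noteq> 0} \<subseteq>
    {d. \<exists>x\<in>G d. \<phi> x \<noteq> 0} \<union> {d. \<exists>x\<in>G d. \<psi> x \<noteq> 0}"
    using graded_part_subset by fastforce
  then show "finite {d. \<exists>x\<in>G d. (\<lambda>x\<in>carrier V. \<phi> x + \<psi> x) x \<noteq> 0}"
    by (rule finite_subset) (use assms graded_dual_memD(4) in blast)
qed (use graded_dual_memD[OF assms(1)] graded_dual_memD[OF assms(2)] in \<open>auto simp: algebra_simps\<close>)

lemma graded_dual_smult_closed:
  assumes "\<phi> \<in> carrier (graded_dual V G)"
  shows "(\<lambda>x\<in>carrier V. c * \<phi> x) \<in> carrier (graded_dual V G)"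
proof (rule graded_dual_memI)
  have "{d. \<exists>x\<in>G d. (\<lambda>x\<in>carrier V. c * \<phi> x) x \<noteq> 0} \<subseteq> {d. \<exists>x\<in>G d. \<phi> x \<noteq> 0}"
    using graded_part_subset by fastforce
  then show "finite {d. \<exists>x\<in>G d. (\<lambda>x\<in>carrier V. c * \<phi> x) x \<noteq> 0}"
    by (rule finite_subset) (use assms graded_dual_memD(4) in blast)
qed (use graded_dual_memD[OF assms(1)] in \<open>auto simp: algebra_simps\<close>)

lemma graded_dual_zero_closed: "(\<lambda>x\<in>carrier V. 0) \<in> carrier (graded_dual V G)"
  by (rule graded_dual_memI) (use graded_part_subset in \<open>auto simp: subset_iff\<close>)

lemma graded_dual_module: "module complex_field (graded_dual V G)"
proof (rule moduleI)
  show "cring complex_field" by (rule cring_complex_field)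
  show "abelian_group (graded_dual V G)"
  proof (rule abelian_groupI)
    fix \<phi> assume \<phi>: "\<phi> \<in> carrier (graded_dual V G)"
    show "\<zero>\<^bsub>graded_dual V G\<^esub> \<oplus>\<^bsub>graded_dual V G\<^esub> \<phi> = \<phi>"
      using graded_dual_memD(1)[OF \<phi>] by (auto simp: fun_eq_iff extensional_def)
    show "\<exists>\<psi>\<in>carrier (graded_dual V G). \<psi> \<oplus>\<^bsub>graded_dual V G\<^esub> \<phi> = \<zero>\<^bsub>graded_dual V G\<^esub>"
      by (rule bexI[OF _ graded_dual_smult_closed[OF \<phi>, of "-1"]]) (auto simp: fun_eq_iff)
  qed (auto simp: graded_dual_add_closed graded_dual_zero_closed fun_eq_iff)
  show "\<one>\<^bsub>complex_field\<^esub> \<odot>\<^bsub>graded_dual V G\<^esub> \<phi> = \<phi>" if "\<phi> \<in> carrier (graded_dual V G)" for \<phi>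
    using graded_dual_memD(1)[OF that] by (auto simp: fun_eq_iff extensional_def)
qed (auto simp: graded_dual_smult_closed fun_eq_iff algebra_simps)

lemma dual_grading_submodule: "submodule (dual_grading V G d) complex_field (graded_dual V G)"
proof -
  interpret D: module complex_field "graded_dual V G" by (rule graded_dual_module)
  have smult: "c \<odot>\<^bsub>graded_dual V G\<^esub> \<phi> \<in> dual_grading V G d" if "\<phi> \<in> dual_grading V G d" for c \<phi>
    using that graded_part_subset by (auto simp: dual_grading_def graded_dual_smult_closed)
  show ?thesis
  proof (rule D.submoduleI)
    show "dual_grading V G d \<subseteq> carrier (graded_dual V G)" by (auto simp: dual_grading_def)
    show "\<zero>\<^bsub>graded_dual V G\<^esub> \<in> dual_grading V G d"
      using graded_part_subset by (auto simp: dual_grading_def graded_dual_zero_closed)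
    show "\<ominus>\<^bsub>graded_dual V G\<^esub> \<phi> \<in> dual_grading V G d" if "\<phi> \<in> dual_grading V G d" for \<phi>
    proof -
      have \<phi>: "\<phi> \<in> carrier (graded_dual V G)" using that by (simp add: dual_grading_def)
      have "\<ominus>\<^bsub>graded_dual V G\<^esub> \<phi> = (-1) \<odot>\<^bsub>graded_dual V G\<^esub> \<phi>"
        by (rule abelian_group.minus_equality)
          (use \<phi> graded_dual_smult_closed[OF \<phi>, of "-1"] D.abelian_group_axioms in \<open>auto simp: fun_eq_iff\<close>)
      then show ?thesis using smult[OF that, of "-1"] by simp
    qed
    show "\<phi> \<oplus>\<^bsub>graded_dual V G\<^esub> \<psi> \<in> dual_grading V G d"
      if "\<phi> \<in> dual_grading V G d" "\<psi> \<in> dual_grading V G d" for \<phi> \<psi>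
      using that graded_part_subset by (auto simp: dual_grading_def graded_dual_add_closed)
  qed (rule smult)
qed

lemma graded_dual_finsum:
  assumes "finite D" "\<And>d. F d \<in> carrier (graded_dual V G)" "x \<in> carrier V"
  shows "(\<Oplus>\<^bsub>graded_dual V G\<^esub>d\<in>D. F d) x = (\<Sum>d\<in>D. F d x)"
proof -
  interpret D: module complex_field "graded_dual V G" by (rule graded_dual_module)
  show ?thesis using assms(1)
    by (induction D rule: finite_induct) (use assms(2,3) in auto)
qed

lemma graded_dual_apply_finsum:
  assumes "finite D" "\<And>d. c d \<in> carrier V" "\<phi> \<in> carrier (graded_dual V G)"
  shows "\<phi> (\<Oplus>\<^bsub>V\<^esub>d\<in>D. c d) = (\<Sum>d\<in>D. \<phi> (c d))"
  using assms(1)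
  by (induction D rule: finite_induct)
    (use assms(2,3) in \<open>auto simp: graded_dual_zero graded_dual_memD(2)\<close>)

text \<open>The projection of a functional to degree \<open>d\<close> is its composition with the projection of
  \<open>V\<close> to degree \<open>d\<close>.  A functional is the sum of these because each vector has finitely many
  components, and the sum is finite because the functional vanishes on almost all degrees.\<close>

lemma graded_dual_graded: "graded_vector_space (graded_dual V G) (dual_grading V G)"
proof (rule graded_vector_spaceI)
  interpret D: module complex_field "graded_dual V G" by (rule graded_dual_module)
  define \<pi> where "\<pi> d \<phi> = (\<lambda>x\<in>carrier V. \<phi> (component V G d x) :: complex)" for d \<phi>
  show "module complex_field (graded_dual V G)" by (rule graded_dual_module)
  show "submodule (dual_grading V G d) complex_field (graded_dual V G)" for d
    by (rule dual_grading_submodule)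
  have comp: "component V G d x \<in> carrier V" if "x \<in> carrier V" for d x
    using component(1)[OF that] graded_part_subset by blast
  show mem: "\<pi> d \<phi> \<in> dual_grading V G d" if \<phi>: "\<phi> \<in> carrier (graded_dual V G)" for d \<phi>
  proof -
    have other: "\<pi> d \<phi> x = 0" if "x \<in> G e" "e \<noteq> d" for e x
      using component_same[OF that(1)] that graded_part_subset[of e] graded_dual_zero[OF \<phi>]
      by (auto simp: \<pi>_def)
    then have "{e. \<exists>x\<in>G e. \<pi> d \<phi> x \<noteq> 0} \<subseteq> {d}" by auto
    then have "finite {e. \<exists>x\<in>G e. \<pi> d \<phi> x \<noteq> 0}" by (rule finite_subset) simp
    then have "\<pi> d \<phi> \<in> carrier (graded_dual V G)"
      by (intro graded_dual_memI)
        (auto simp: \<pi>_def component_add component_smult comp graded_dual_memD[OF \<phi>])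
    then show ?thesis using other by (auto simp: dual_grading_def)
  qed
  show "\<pi> d (\<phi> \<oplus>\<^bsub>graded_dual V G\<^esub> \<psi>) = \<pi> d \<phi> \<oplus>\<^bsub>graded_dual V G\<^esub> \<pi> d \<psi>" for d \<phi> \<psi>
    by (auto simp: \<pi>_def comp fun_eq_iff)
  have sum: "\<phi> x = (\<Sum>d\<in>D. \<phi> (component V G d x))"
    if "\<phi> \<in> carrier (graded_dual V G)" "x \<in> carrier V" "finite D"
      "\<And>d. d \<notin> D \<Longrightarrow> \<phi> (component V G d x) = 0" for \<phi> x D
  proof -
    define E where "E = D \<union> {d. component V G d x \<noteq> \<zero>\<^bsub>V\<^esub>}"
    have E: "finite E" using that(3) component(2)[OF that(2)] by (simp add: E_def)
    have "x = (\<Oplus>\<^bsub>V\<^esub>d\<in>E. component V G d x)"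
      by (rule component_sum[OF that(2) E]) (simp add: E_def)
    then have "\<phi> x = (\<Sum>d\<in>E. \<phi> (component V G d x))"
      using graded_dual_apply_finsum[OF E, of "\<lambda>d. component V G d x"] comp[OF that(2)] that(1) by simp
    also have "\<dots> = (\<Sum>d\<in>D. \<phi> (component V G d x))"
      by (rule sum.mono_neutral_right[OF E]) (use that(4) in \<open>auto simp: E_def\<close>)
    finally show ?thesis .
  qed
  show "\<pi> d \<phi> = \<phi>" if "\<phi> \<in> dual_grading V G d" for d \<phi>
  proof
    have \<phi>: "\<phi> \<in> carrier (graded_dual V G)" using that by (simp add: dual_grading_def)
    fix x
    show "\<pi> d \<phi> x = \<phi> x"
    proof (cases "x \<in> carrier V")
      case True
      have "\<phi> (component V G e x) = 0" if "e \<notin> {d}" for e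
        using that \<open>\<phi> \<in> dual_grading V G d\<close> component(1)[OF True] by (auto simp: dual_grading_def)
      then show ?thesis using sum[OF \<phi> True, of "{d}"] True by (simp add: \<pi>_def)
    next
      case False
      then show ?thesis using graded_dual_memD(1)[OF \<phi>] by (auto simp: \<pi>_def extensional_def)
    qed
  qed
  show "\<pi> d \<phi> = \<zero>\<^bsub>graded_dual V G\<^esub>" if "\<phi> \<in> dual_grading V G e" "e \<noteq> d" for d e \<phi>
  proof -
    have "d \<noteq> e" using that(2) by simp
    with that(1) have "\<forall>x\<in>G d. \<phi> x = 0" by (simp add: dual_grading_def)
    then have "\<phi> (component V G d x) = 0" if "x \<in> carrier V" for x
      using component(1)[OF that] by (rule bspec)
    then show ?thesis by (auto simp: \<pi>_def fun_eq_iff)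
  qed
  fix \<phi> assume \<phi>: "\<phi> \<in> carrier (graded_dual V G)"
  have "{d. \<pi> d \<phi> \<noteq> \<zero>\<^bsub>graded_dual V G\<^esub>} \<subseteq> {d. \<exists>x\<in>G d. \<phi> x \<noteq> 0}"
  proof
    fix d assume "d \<in> {d. \<pi> d \<phi> \<noteq> \<zero>\<^bsub>graded_dual V G\<^esub>}"
    then obtain x where "x \<in> carrier V" "\<phi> (component V G d x) \<noteq> 0"
      by (auto simp: \<pi>_def restrict_def fun_eq_iff split: if_splits)
    then show "d \<in> {d. \<exists>x\<in>G d. \<phi> x \<noteq> 0}" using component(1) by auto
  qed
  then show fin: "finite {d. \<pi> d \<phi> \<noteq> \<zero>\<^bsub>graded_dual V G\<^esub>}"
    by (rule finite_subset) (rule graded_dual_memD(4)[OF \<phi>])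
  have mem': "\<pi> d \<phi> \<in> carrier (graded_dual V G)" for d
    using mem[OF \<phi>] by (simp add: dual_grading_def)
  show "\<phi> = (\<Oplus>\<^bsub>graded_dual V G\<^esub>d\<in>{d. \<pi> d \<phi> \<noteq> \<zero>\<^bsub>graded_dual V G\<^esub>}. \<pi> d \<phi>)" (is "_ = ?S")
  proof
    fix x
    have "?S \<in> carrier (graded_dual V G)" using mem' by (intro D.finsum_closed) simp
    note ext = graded_dual_memD(1)[OF this] graded_dual_memD(1)[OF \<phi>]
    show "\<phi> x = ?S x"
    proof (cases "x \<in> carrier V")
      case True
      have "\<phi> (component V G d x) = 0" if "d \<notin> {d. \<pi> d \<phi> \<noteq> \<zero>\<^bsub>graded_dual V G\<^esub>}" for d
      proof -
        have "\<pi> d \<phi> = (\<lambda>x\<in>carrier V. 0)" using that by simp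
        from fun_cong[OF this, of x] show ?thesis using True by (simp add: \<pi>_def)
      qed
      from sum[OF \<phi> True fin this]
      have "\<phi> x = (\<Sum>d\<in>{d. \<pi> d \<phi> \<noteq> \<zero>\<^bsub>graded_dual V G\<^esub>}. \<phi> (component V G d x))" .
      also have "\<dots> = (\<Sum>d\<in>{d. \<pi> d \<phi> \<noteq> \<zero>\<^bsub>graded_dual V G\<^esub>}. \<pi> d \<phi> x)"
        by (intro sum.cong refl) (simp add: \<pi>_def True)
      also have "\<dots> = ?S x"
        by (rule graded_dual_finsum[OF fin mem' True, symmetric])
      finally show ?thesis .
    next
      case False
      show ?thesis
        unfolding extensional_arb[OF ext(1) False] extensional_arb[OF ext(2) False] ..
    qed
  qed
qed

end

lemma (in graded_cofi_module) dual_graded_fi_module: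
  "graded_fi_module (\<lambda>n. graded_dual (V n) (G n)) (\<lambda>n. dual_grading (V n) (G n)) (dual_act V act)"
proof (intro graded_fi_module.intro fi_module.intro graded_fi_module_axioms.intro)
  have act_mem: "act m n f x \<in> carrier (V m)" if "1 \<le> m" "1 \<le> n" "f \<in> fi_hom m n" "x \<in> carrier (V n)" for m n f x
    using act_hom[OF that(1-3)] that(4) by (auto simp: lin_hom_def)
  have act_add: "act m n f (x \<oplus>\<^bsub>V n\<^esub> y) = act m n f x \<oplus>\<^bsub>V m\<^esub> act m n f y"
    if "1 \<le> m" "1 \<le> n" "f \<in> fi_hom m n" "x \<in> carrier (V n)" "y \<in> carrier (V n)" for m n f x y
    using act_hom[OF that(1-3)] that by (auto simp: lin_hom_def)
  have act_smult: "act m n f (c \<odot>\<^bsub>V n\<^esub> x) = c \<odot>\<^bsub>V m\<^esub> act m n f x"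
    if "1 \<le> m" "1 \<le> n" "f \<in> fi_hom m n" "x \<in> carrier (V n)" for m n f x c
    using act_hom[OF that(1-3)] that by (auto simp: lin_hom_def)
  have closed: "x \<oplus>\<^bsub>V n\<^esub> y \<in> carrier (V n)" "c \<odot>\<^bsub>V n\<^esub> x \<in> carrier (V n)"
    if "1 \<le> n" "x \<in> carrier (V n)" "y \<in> carrier (V n)" for n c x y
  proof -
    interpret module complex_field "V n" using vector_space[OF that(1)] .
    show "x \<oplus>\<^bsub>V n\<^esub> y \<in> carrier (V n)" "c \<odot>\<^bsub>V n\<^esub> x \<in> carrier (V n)" using that by auto
  qed
  note sub = graded_vector_space.graded_part_subset[OF graded]
  have dual_mem: "dual_act V act m n f \<phi> \<in> carrier (graded_dual (V n) (G n))"
    if mnf: "1 \<le> m" "1 \<le> n" "f \<in> fi_hom m n" and \<phi>: "\<phi> \<in> carrier (graded_dual (V m) (G m))" for m n f \<phi>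
  proof (rule graded_dual_memI)
    have "{d. \<exists>x\<in>G n d. dual_act V act m n f \<phi> x \<noteq> 0} \<subseteq> {d. \<exists>x\<in>G m d. \<phi> x \<noteq> 0}"
      using sub[OF mnf(2)] act_graded[OF mnf] by (fastforce simp: dual_act_def)
    then show "finite {d. \<exists>x\<in>G n d. dual_act V act m n f \<phi> x \<noteq> 0}"
      by (rule finite_subset) (rule graded_dual_memD(4)[OF \<phi>])
  qed (auto simp: dual_act_def act_mem[OF mnf] act_add[OF mnf] act_smult[OF mnf] closed[OF mnf(2)]
      graded_dual_memD(2,3)[OF \<phi>])
  show "module complex_field (graded_dual (V n) (G n))" if "1 \<le> n" for n
    using graded_vector_space.graded_dual_module[OF graded[OF that]] .
  show "dual_act V act m n f \<in> lin_hom (graded_dual (V m) (G m)) (graded_dual (V n) (G n))"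
    if mnf: "1 \<le> m" "1 \<le> n" "f \<in> fi_hom m n" for m n f
    using dual_mem[OF mnf] by (auto simp: lin_hom_def dual_act_def act_mem[OF mnf] fun_eq_iff)
  show "dual_act V act n n (fi_id n) \<phi> = \<phi>"
    if "1 \<le> n" "\<phi> \<in> carrier (graded_dual (V n) (G n))" for n \<phi>
    using graded_dual_memD(1)[OF that(2)] act_id[OF that(1)]
    by (auto simp: dual_act_def fun_eq_iff extensional_def)
  show "dual_act V act l n (fi_comp l g f) \<phi> = dual_act V act m n g (dual_act V act l m f \<phi>)"
    if "1 \<le> l" "1 \<le> m" "1 \<le> n" "f \<in> fi_hom l m" "g \<in> fi_hom m n" for l m n f g \<phi>
    using act_comp[OF that] act_mem[OF that(2,3,5)] by (auto simp: dual_act_def fun_eq_iff)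
  show "graded_vector_space (graded_dual (V n) (G n)) (dual_grading (V n) (G n))" if "1 \<le> n" for n
    by (rule graded_vector_space.graded_dual_graded[OF graded[OF that]])
  show "dual_act V act m n f ` dual_grading (V m) (G m) d \<subseteq> dual_grading (V n) (G n) d"
    if mnf: "1 \<le> m" "1 \<le> n" "f \<in> fi_hom m n" for m n f d
  proof
    fix \<psi> assume "\<psi> \<in> dual_act V act m n f ` dual_grading (V m) (G m) d"
    then obtain \<phi> where \<phi>: "\<phi> \<in> dual_grading (V m) (G m) d" "\<psi> = dual_act V act m n f \<phi>" by auto
    have "\<psi> x = 0" if "x \<in> G n e" "e \<noteq> d" for e x
      using \<phi> that act_graded[OF mnf, of e] sub[OF mnf(2)]
      by (auto simp: dual_act_def dual_grading_def)
    moreover have "\<psi> \<in> carrier (graded_dual (V n) (G n))"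
      using \<phi> dual_mem[OF mnf] by (simp add: dual_grading_def)
    ultimately show "\<psi> \<in> dual_grading (V n) (G n) d" by (simp add: dual_grading_def)
  qed
qed

lemma (in graded_fi_module) graded_part_fi_module:
  "fi_module (\<lambda>n. (V n)\<lparr>carrier := G n d\<rparr>) act"
proof (rule fi_module.intro)
  note sub = graded_vector_space.graded_part_subset[OF graded]
  show "module complex_field ((V n)\<lparr>carrier := G n d\<rparr>)" if "1 \<le> n" for n
    by (rule submodule.submodule_is_module[OF graded_vector_space.graded_part[OF graded[OF that]]
        vector_space[OF that]])
  show "act m n f \<in> lin_hom ((V m)\<lparr>carrier := G m d\<rparr>) ((V n)\<lparr>carrier := G n d\<rparr>)"
    if "1 \<le> m" "1 \<le> n" "f \<in> fi_hom m n" for m n f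
    using act_hom[OF that] act_graded[OF that, of d] sub[OF that(1), of d]
    by (auto simp: lin_hom_def subset_iff image_subset_iff)
  show "act n n (fi_id n) x = x" if "1 \<le> n" "x \<in> carrier ((V n)\<lparr>carrier := G n d\<rparr>)" for n x
    using act_id[OF that(1)] sub[OF that(1)] that(2) by auto
  show "act l n (fi_comp l g f) x = act m n g (act l m f x)"
    if "1 \<le> l" "1 \<le> m" "1 \<le> n" "f \<in> fi_hom l m" "g \<in> fi_hom m n"
      "x \<in> carrier ((V l)\<lparr>carrier := G l d\<rparr>)" for l m n f g x
    using act_comp[OF that(1-5)] sub[OF that(1)] that(6) by auto
qed

section \<open>Polynomial rings and homogeneous parts\<close>

text \<open>Additive statements about polynomials in prescribed monomials need checking only on terms.\<close>

lemma poly_mapping_keys_induct [consumes 1, case_names zero single add]: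
  fixes p :: "'a \<Rightarrow>\<^sub>0 'b::comm_monoid_add"
  assumes "Poly_Mapping.keys p \<subseteq> K"
    and zero: "P 0"
    and single: "\<And>u c. u \<in> K \<Longrightarrow> P (Poly_Mapping.single u c)"
    and add: "\<And>p q. Poly_Mapping.keys p \<subseteq> K \<Longrightarrow> Poly_Mapping.keys q \<subseteq> K \<Longrightarrow> P p \<Longrightarrow> P q \<Longrightarrow> P (p + q)"
  shows "P p"
proof -
  have "p = (\<Sum>u\<in>Poly_Mapping.keys p. Poly_Mapping.single u (Poly_Mapping.lookup p u))"
    by (rule poly_mapping_eqI) (auto simp: lookup_sum lookup_single when_def in_keys_iff)
  moreover have "Poly_Mapping.keys (\<Sum>u\<in>A. Poly_Mapping.single u (Poly_Mapping.lookup p u)) \<subseteq> K \<and>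
      P (\<Sum>u\<in>A. Poly_Mapping.single u (Poly_Mapping.lookup p u))"
    if "finite A" "A \<subseteq> K" for A
    using that
  proof (induction A rule: finite_induct)
    case (insert u A)
    let ?s = "Poly_Mapping.single u (Poly_Mapping.lookup p u)"
    have "Poly_Mapping.keys ?s \<subseteq> K" using insert.prems by simp
    then show ?case
      using insert single[of u] add keys_add[of ?s "\<Sum>u\<in>A. Poly_Mapping.single u (Poly_Mapping.lookup p u)"]
      by auto
  qed (simp add: zero)
  ultimately show ?thesis using assms(1) by (metis finite_keys)
qed

lemma keys_add_nat:
  fixes u v :: "'a \<Rightarrow>\<^sub>0 nat"
  shows "Poly_Mapping.keys (u + v) = Poly_Mapping.keys u \<union> Poly_Mapping.keys v"
  by (auto simp: in_keys_iff lookup_add)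

lemma poly_ring_simps [simp]:
  "mult (poly_ring n) = (*)" "one (poly_ring n) = 1" "zero (poly_ring n) = 0"
  "add (poly_ring n) = (+)" "c \<odot>\<^bsub>poly_ring n\<^esub> p = poly_const c * p"
  by (simp_all add: poly_ring_def)

lemma poly_ring_carrier:
  "p \<in> carrier (poly_ring n) \<longleftrightarrow> Poly_Mapping.keys p \<subseteq> {u. Poly_Mapping.keys u \<subseteq> {1..n}}"
  by (auto simp: poly_ring_def)

lemma poly_ring_single:
  "Poly_Mapping.keys u \<subseteq> {1..n} \<Longrightarrow> Poly_Mapping.single u c \<in> carrier (poly_ring n)"
  by (auto simp: poly_ring_carrier)

lemma poly_ring_zero: "0 \<in> carrier (poly_ring n)"
  by (auto simp: poly_ring_carrier)

lemma poly_ring_one: "1 \<in> carrier (poly_ring n)"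
  using poly_ring_single[of 0 n 1] by simp

lemma poly_ring_const: "poly_const c \<in> carrier (poly_ring n)"
  unfolding poly_const_def by (rule poly_ring_single) simp

lemma poly_ring_uminus: "p \<in> carrier (poly_ring n) \<Longrightarrow> - p \<in> carrier (poly_ring n)"
  by (auto simp: poly_ring_carrier in_keys_iff)

lemma poly_ring_add:
  "p \<in> carrier (poly_ring n) \<Longrightarrow> q \<in> carrier (poly_ring n) \<Longrightarrow> p + q \<in> carrier (poly_ring n)"
  using keys_add[of p q] by (fastforce simp: poly_ring_carrier)

lemma poly_ring_diff:
  "p \<in> carrier (poly_ring n) \<Longrightarrow> q \<in> carrier (poly_ring n) \<Longrightarrow> p - q \<in> carrier (poly_ring n)"
  using poly_ring_add[of p n "- q"] poly_ring_uminus[of q n] by simp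

lemma poly_ring_mult:
  assumes "p \<in> carrier (poly_ring n)" "q \<in> carrier (poly_ring n)"
  shows "p * q \<in> carrier (poly_ring n)"
proof -
  have "Poly_Mapping.keys w \<subseteq> {1..n}" if "w \<in> Poly_Mapping.keys (p * q)" for w
  proof -
    obtain u v where "w = u + v" "u \<in> Poly_Mapping.keys p" "v \<in> Poly_Mapping.keys q"
      using \<open>w \<in> Poly_Mapping.keys (p * q)\<close> keys_mult[of p q] by blast
    then show ?thesis using assms by (auto simp: poly_ring_carrier keys_add_nat subset_iff)
  qed
  then show ?thesis by (auto simp: poly_ring_carrier)
qed

lemmas poly_ring_closed = poly_ring_zero poly_ring_one poly_ring_const poly_ring_uminus
  poly_ring_add poly_ring_diff poly_ring_mult

lemma poly_ring_sum:
  "(\<And>i. i \<in> A \<Longrightarrow> p i \<in> carrier (poly_ring n)) \<Longrightarrow> sum p A \<in> carrier (poly_ring n)"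
  by (induction A rule: infinite_finite_induct) (auto simp: poly_ring_closed)

lemma poly_ring_cring: "cring (poly_ring n)"
proof (rule cringI)
  show "abelian_group (poly_ring n)"
    by (rule abelian_groupI)
      (auto simp: poly_ring_closed algebra_simps intro!: bexI[of _ "- x" for x])
  show "Group.comm_monoid (poly_ring n)"
    by (rule comm_monoidI) (auto simp: poly_ring_closed algebra_simps)
qed (auto simp: algebra_simps)

lemma poly_const_simps:
  "poly_const 1 = 1" "poly_const 0 = 0" "poly_const (a + b) = poly_const a + poly_const b"
  "poly_const (a * b) = poly_const a * poly_const b"
  by (simp_all add: poly_const_def single_add mult_single)

lemma poly_const_single: "poly_const c * Poly_Mapping.single u a = Poly_Mapping.single u (c * a)"
  by (simp add: poly_const_def mult_single)

lemma homogeneous_polys_iff: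
  "p \<in> homogeneous_polys n d \<longleftrightarrow> Poly_Mapping.keys p \<subseteq> monomials n d"
  by (auto simp: homogeneous_polys_def poly_ring_carrier monomials_def)

lemma mon_degree_zero [simp]: "mon_degree 0 = 0"
  by (simp add: mon_degree_def)

lemma mon_degree_add: "mon_degree (u + v) = mon_degree u + mon_degree v"
proof -
  let ?A = "Poly_Mapping.keys u \<union> Poly_Mapping.keys v"
  have "mon_degree (u + v) = (\<Sum>i\<in>?A. Poly_Mapping.lookup (u + v) i)"
    by (rule mon_degree_superset) (auto simp: keys_add_nat)
  also have "\<dots> = (\<Sum>i\<in>?A. Poly_Mapping.lookup u i) + (\<Sum>i\<in>?A. Poly_Mapping.lookup v i)"
    by (simp add: lookup_add sum.distrib)
  also have "\<dots> = mon_degree u + mon_degree v"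
    using mon_degree_superset[of ?A u] mon_degree_superset[of ?A v] by simp
  finally show ?thesis .
qed

definition hom_part :: "nat \<Rightarrow> cpoly \<Rightarrow> cpoly" where
  "hom_part d p = Abs_poly_mapping (\<lambda>u. if mon_degree u = d then Poly_Mapping.lookup p u else 0)"

lemma lookup_hom_part:
  "Poly_Mapping.lookup (hom_part d p) u = (if mon_degree u = d then Poly_Mapping.lookup p u else 0)"
proof -
  have "finite {u. (if mon_degree u = d then Poly_Mapping.lookup p u else 0) \<noteq> 0}"
    by (rule finite_subset[OF _ finite_lookup[of p]]) auto
  then show ?thesis by (simp add: hom_part_def)
qed

lemma keys_hom_part: "Poly_Mapping.keys (hom_part d p) = {u\<in>Poly_Mapping.keys p. mon_degree u = d}"
  by (auto simp: in_keys_iff lookup_hom_part split: if_splits)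

lemma hom_part_zero [simp]: "hom_part d 0 = 0"
  by (rule poly_mapping_eqI) (simp add: lookup_hom_part)

lemma hom_part_add: "hom_part d (p + q) = hom_part d p + hom_part d q"
  by (rule poly_mapping_eqI) (simp add: lookup_hom_part lookup_add)

lemma hom_part_diff: "hom_part d (p - q) = hom_part d p - hom_part d q"
  by (rule poly_mapping_eqI) (simp add: lookup_hom_part lookup_minus)

lemma hom_part_single:
  "hom_part d (Poly_Mapping.single u c) = (if mon_degree u = d then Poly_Mapping.single u c else 0)"
  by (rule poly_mapping_eqI) (auto simp: lookup_hom_part lookup_single when_def)

lemma hom_part_homogeneous:
  "p \<in> homogeneous_polys n e \<Longrightarrow> hom_part d p = (if d = e then p else 0)"
  by (rule poly_mapping_eqI)
    (auto simp: lookup_hom_part homogeneous_polys_def in_keys_iff dest: bspec)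

lemma hom_part_mem: "p \<in> carrier (poly_ring n) \<Longrightarrow> hom_part d p \<in> homogeneous_polys n d"
  by (auto simp: homogeneous_polys_iff keys_hom_part monomials_def poly_ring_carrier)

text \<open>Multiplication by a term shifts degrees, which is why being closed under homogeneous parts
  passes from generators to the ideal they generate.\<close>

lemma hom_part_single_mult:
  "hom_part d (Poly_Mapping.single u c * p) =
    (if mon_degree u \<le> d then Poly_Mapping.single u c * hom_part (d - mon_degree u) p else 0)"
proof -
  have "Poly_Mapping.keys p \<subseteq> UNIV" by simp
  then show ?thesis
    by (induction p rule: poly_mapping_keys_induct)
      (auto simp: mult_single hom_part_single mon_degree_add hom_part_add algebra_simps)
qed

lemma finite_hom_parts: "finite {d. hom_part d p \<noteq> 0}"
proof (rule finite_subset)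
  show "{d. hom_part d p \<noteq> 0} \<subseteq> mon_degree ` Poly_Mapping.keys p"
  proof
    fix d assume "d \<in> {d. hom_part d p \<noteq> 0}"
    then obtain u where "u \<in> Poly_Mapping.keys (hom_part d p)"
      using keys_eq_empty[of "hom_part d p"] by blast
    then show "d \<in> mon_degree ` Poly_Mapping.keys p" by (auto simp: keys_hom_part)
  qed
qed simp

lemma sum_hom_parts:
  assumes "finite D" "{d. hom_part d p \<noteq> 0} \<subseteq> D"
  shows "p = (\<Sum>d\<in>D. hom_part d p)"
proof (rule poly_mapping_eqI)
  fix u
  have "Poly_Mapping.lookup p u = 0" if "mon_degree u \<notin> D"
  proof -
    have "hom_part (mon_degree u) p = 0" using assms(2) that by auto
    then show ?thesis using lookup_hom_part[of "mon_degree u" p u] by simp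
  qed
  then show "Poly_Mapping.lookup p u = Poly_Mapping.lookup (\<Sum>d\<in>D. hom_part d p) u"
    using assms(1) by (auto simp: lookup_sum lookup_hom_part)
qed

section \<open>The co-FI structure on polynomials\<close>

lemma poly_subst_superset:
  assumes "finite A" "Poly_Mapping.keys p \<subseteq> A"
  shows "poly_subst \<sigma> p = (\<Sum>u\<in>A. poly_const (Poly_Mapping.lookup p u) *
       (\<Prod>i\<in>Poly_Mapping.keys u. \<sigma> i ^ Poly_Mapping.lookup u i))"
  unfolding poly_subst_def
  by (rule sum.mono_neutral_left) (use assms in \<open>auto simp: in_keys_iff poly_const_simps\<close>)

lemma poly_subst_add: "poly_subst \<sigma> (p + q) = poly_subst \<sigma> p + poly_subst \<sigma> q"
proof -
  let ?A = "Poly_Mapping.keys p \<union> Poly_Mapping.keys q"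
  have "Poly_Mapping.keys (p + q) \<subseteq> ?A" by (rule keys_add)
  then show ?thesis
    using poly_subst_superset[of ?A p] poly_subst_superset[of ?A q] poly_subst_superset[of ?A "p + q"]
    by (simp add: lookup_add poly_const_simps distrib_right sum.distrib)
qed

lemma poly_subst_single:
  "poly_subst \<sigma> (Poly_Mapping.single u c) =
    poly_const c * (\<Prod>i\<in>Poly_Mapping.keys u. \<sigma> i ^ Poly_Mapping.lookup u i)"
  by (subst poly_subst_superset[of "{u}"]) auto

lemma pullback_zero [simp]: "poly_pullback m f 0 = 0"
  by (simp add: poly_pullback_def poly_subst_def)

lemma pullback_add: "poly_pullback m f (p + q) = poly_pullback m f p + poly_pullback m f q"
  by (simp add: poly_pullback_def poly_subst_add)

lemma pullback_diff: "poly_pullback m f (p - q) = poly_pullback m f p - poly_pullback m f q"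
  using pullback_add[of m f "p - q" q] by simp

lemma pullback_sum: "poly_pullback m f (sum g A) = (\<Sum>i\<in>A. poly_pullback m f (g i))"
  by (induction A rule: infinite_finite_induct) (auto simp: pullback_add)

lemma poly_var_power: "poly_var j ^ k = Poly_Mapping.single (Poly_Mapping.single j k) 1"
  by (induction k) (auto simp: poly_var_def mult_single single_add[symmetric])

lemma prod_poly_var_power:
  "finite A \<Longrightarrow> (\<Prod>j\<in>A. poly_var j ^ e j) =
    Poly_Mapping.single (\<Sum>j\<in>A. Poly_Mapping.single j (e j)) 1"
  by (induction A rule: finite_induct) (auto simp: poly_var_power mult_single)

lemma pullback_single:
  assumes inj: "inj_on f {1..m}"
  shows "poly_pullback m f (Poly_Mapping.single v c) =
    (if Poly_Mapping.keys v \<subseteq> f ` {1..m} then Poly_Mapping.single (pull_mon m f v) c else 0)"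
proof (cases "Poly_Mapping.keys v \<subseteq> f ` {1..m}")
  case True
  let ?\<sigma> = "\<lambda>i. if i \<in> f ` {1..m} then poly_var (the_inv_into {1..m} f i) else 0"
  have "(\<Prod>i\<in>Poly_Mapping.keys v. ?\<sigma> i ^ Poly_Mapping.lookup v i) =
      (\<Prod>i\<in>f ` {1..m}. ?\<sigma> i ^ Poly_Mapping.lookup v i)"
    by (rule prod.mono_neutral_left) (use True in \<open>auto simp: in_keys_iff\<close>)
  also have "\<dots> = (\<Prod>j\<in>{1..m}. poly_var j ^ Poly_Mapping.lookup v (f j))"
    using inj by (simp add: prod.reindex the_inv_into_f_f)
  also have "\<dots> = Poly_Mapping.single (\<Sum>j\<in>{1..m}. Poly_Mapping.single j (Poly_Mapping.lookup v (f j))) 1"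
    by (rule prod_poly_var_power) simp
  also have "(\<Sum>j\<in>{1..m}. Poly_Mapping.single j (Poly_Mapping.lookup v (f j))) = pull_mon m f v"
    by (rule poly_mapping_eqI) (auto simp: lookup_sum lookup_pull_mon lookup_single when_def)
  finally show ?thesis
    using True by (simp add: poly_pullback_def poly_subst_single poly_const_single)
next
  case False
  then obtain i where i: "i \<in> Poly_Mapping.keys v" "i \<notin> f ` {1..m}" by auto
  let ?\<sigma> = "\<lambda>i. if i \<in> f ` {1..m} then poly_var (the_inv_into {1..m} f i) else 0"
  have "?\<sigma> i ^ Poly_Mapping.lookup v i = 0" using i by (simp add: in_keys_iff power_0_left)
  then have "(\<Prod>i\<in>Poly_Mapping.keys v. ?\<sigma> i ^ Poly_Mapping.lookup v i) = 0"
    by (rule prod_zero[OF finite_keys bexI[OF _ i(1)]])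
  then show ?thesis using False by (simp add: poly_pullback_def poly_subst_single)
qed

lemma pull_mon_add: "pull_mon m f (u + v) = pull_mon m f u + pull_mon m f v"
  by (rule poly_mapping_eqI) (simp add: lookup_pull_mon lookup_add)

text \<open>Both sides are biadditive, so it suffices to compare products of terms; a product of two terms
  survives exactly if both factors do.\<close>

lemma pullback_mult:
  assumes inj: "inj_on f {1..m}"
  shows "poly_pullback m f (p * q) = poly_pullback m f p * poly_pullback m f q"
proof -
  have single: "poly_pullback m f (Poly_Mapping.single u a * q) =
    poly_pullback m f (Poly_Mapping.single u a) * poly_pullback m f q" for u a
  proof -
    have "Poly_Mapping.keys q \<subseteq> UNIV" by simp
    then show ?thesis
    proof (induction q rule: poly_mapping_keys_induct)
      case (single v b)
      then show ?case by (simp add: mult_single pullback_single[OF inj] keys_add_nat pull_mon_add)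
    qed (simp_all add: pullback_add distrib_left)
  qed
  have "Poly_Mapping.keys p \<subseteq> UNIV" by simp
  then show ?thesis
    by (induction p rule: poly_mapping_keys_induct) (simp_all add: single pullback_add distrib_right)
qed

lemma pullback_const:
  assumes inj: "inj_on f {1..m}"
  shows "poly_pullback m f (poly_const c) = poly_const c"
proof -
  have "pull_mon m f 0 = 0" by (rule poly_mapping_eqI) (simp add: lookup_pull_mon)
  then show ?thesis by (simp add: poly_const_def pullback_single[OF inj])
qed

lemma pullback_prod:
  assumes inj: "inj_on f {1..m}"
  shows "poly_pullback m f (prod g A) = (\<Prod>i\<in>A. poly_pullback m f (g i))"
  using pullback_const[OF inj, of 1]
  by (induction A rule: infinite_finite_induct) (auto simp: pullback_mult[OF inj] poly_const_simps)

lemma pullback_homogeneous: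
  assumes inj: "inj_on f {1..m}" and "p \<in> homogeneous_polys n d"
  shows "poly_pullback m f p \<in> homogeneous_polys m d"
  using assms(2) unfolding homogeneous_polys_iff
proof (induction p rule: poly_mapping_keys_induct)
  case (single u c)
  then show ?case using pull_mon_mem_monomials[OF inj] by (auto simp: pullback_single[OF inj])
next
  case (add p q)
  then show ?case using keys_add[of "poly_pullback m f p" "poly_pullback m f q"] by (auto simp: pullback_add)
qed simp

lemma pullback_carrier:
  assumes inj: "inj_on f {1..m}"
  shows "poly_pullback m f p \<in> carrier (poly_ring m)"
proof -
  have "Poly_Mapping.keys p \<subseteq> UNIV" by simp
  then show ?thesis
  proof (induction p rule: poly_mapping_keys_induct)
    case (single u c)
    have "Poly_Mapping.keys (pull_mon m f u) \<subseteq> {1..m}" by (auto simp: keys_pull_mon)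
    then show ?case by (simp add: pullback_single[OF inj] poly_ring_zero poly_ring_single)
  qed (simp_all add: poly_ring_zero poly_ring_add pullback_add)
qed

lemma pullback_id:
  assumes "p \<in> carrier (poly_ring n)"
  shows "poly_pullback n (fi_id n) p = p"
proof -
  have inj: "inj_on (fi_id n) {1..n}" by (auto simp: fi_id_def inj_on_def)
  from assms have "Poly_Mapping.keys p \<subseteq> {u. Poly_Mapping.keys u \<subseteq> {1..n}}"
    by (simp add: poly_ring_carrier)
  then show ?thesis
  proof (induction p rule: poly_mapping_keys_induct)
    case (single u c)
    have "fi_id n ` {1..n} = {1..n}" by (auto simp: fi_id_def)
    moreover have "pull_mon n (fi_id n) u = u"
    proof (rule poly_mapping_eqI)
      fix i show "Poly_Mapping.lookup (pull_mon n (fi_id n) u) i = Poly_Mapping.lookup u i"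
        using single by (auto simp: lookup_pull_mon fi_id_def in_keys_iff subset_iff)
    qed
    ultimately show ?case using single by (simp add: pullback_single[OF inj])
  qed (simp_all add: pullback_add)
qed

lemma fi_comp_mem:
  assumes f: "f \<in> fi_hom l m" and g: "g \<in> fi_hom m n"
  shows "fi_comp l g f \<in> fi_hom l n"
proof -
  have sub: "f ` {1..l} \<subseteq> {1..m}" "g ` {1..m} \<subseteq> {1..n}"
    using f g by (auto simp: fi_hom_def)
  have "inj_on (g \<circ> f) {1..l}"
    using f g inj_on_subset[OF _ sub(1)] by (intro comp_inj_on) (auto simp: fi_hom_def)
  moreover have "inj_on (compose {1..l} g f) {1..l} \<longleftrightarrow> inj_on (g \<circ> f) {1..l}"
    by (rule inj_on_cong) (simp add: compose_def)
  moreover have "compose {1..l} g f \<in> {1..l} \<rightarrow>\<^sub>E {1..n}"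
    using sub by (auto simp: compose_def image_subset_iff)
  ultimately show ?thesis by (simp add: fi_hom_def fi_comp_def)
qed

text \<open>On a term this says that the variables of \<open>v\<close> lie in the image of the composite exactly if they
  lie in the image of \<open>g\<close> and their preimages lie in the image of \<open>f\<close>.\<close>

lemma pullback_comp:
  assumes f: "f \<in> fi_hom l m" and g: "g \<in> fi_hom m n"
  shows "poly_pullback l (fi_comp l g f) p = poly_pullback l f (poly_pullback m g p)"
proof -
  have inj: "inj_on f {1..l}" "inj_on g {1..m}" and sub: "f ` {1..l} \<subseteq> {1..m}"
    using f g by (auto simp: fi_hom_def)
  have comp: "fi_comp l g f i = g (f i)" if "i \<in> {1..l}" for i
    using that by (simp add: fi_comp_def compose_def)
  have injc: "inj_on (fi_comp l g f) {1..l}"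
    using fi_comp_mem[OF f g] by (simp add: fi_hom_def)
  have image: "fi_comp l g f ` {1..l} = g ` f ` {1..l}"
    using comp by (auto simp: image_image)
  have "Poly_Mapping.keys p \<subseteq> UNIV" by simp
  then show ?thesis
  proof (induction p rule: poly_mapping_keys_induct)
    case (single v c)
    have "Poly_Mapping.keys v \<subseteq> g ` f ` {1..l} \<longleftrightarrow>
      Poly_Mapping.keys v \<subseteq> g ` {1..m} \<and> Poly_Mapping.keys (pull_mon m g v) \<subseteq> f ` {1..l}"
    proof (intro iffI conjI subsetI)
      fix k assume L: "Poly_Mapping.keys v \<subseteq> g ` f ` {1..l}"
      show "k \<in> g ` {1..m}" if "k \<in> Poly_Mapping.keys v" using L that sub by blast
      show "k \<in> f ` {1..l}" if k: "k \<in> Poly_Mapping.keys (pull_mon m g v)"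
      proof -
        have "k \<in> {1..m}" "g k \<in> Poly_Mapping.keys v" using k by (auto simp: keys_pull_mon)
        then obtain j where j: "j \<in> {1..l}" "g k = g (f j)" using L by blast
        then have "k = f j" using \<open>k \<in> {1..m}\<close> sub by (intro inj_onD[OF inj(2) j(2)]) blast+
        then show ?thesis using j by blast
      qed
    next
      fix k assume R: "Poly_Mapping.keys v \<subseteq> g ` {1..m} \<and> Poly_Mapping.keys (pull_mon m g v) \<subseteq> f ` {1..l}"
        and k: "k \<in> Poly_Mapping.keys v"
      then obtain i where i: "i \<in> {1..m}" "k = g i" by blast
      then have "i \<in> Poly_Mapping.keys (pull_mon m g v)" using k by (simp add: keys_pull_mon)
      then show "k \<in> g ` f ` {1..l}" using R i by blast
    qed
    moreover have "pull_mon l (fi_comp l g f) v = pull_mon l f (pull_mon m g v)"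
      using sub comp by (intro poly_mapping_eqI) (auto simp: lookup_pull_mon image_subset_iff)
    ultimately show ?case
      unfolding pullback_single[OF injc] pullback_single[OF inj(2)] image
      by (simp add: pullback_single[OF inj(1)])
  qed (simp_all add: pullback_add)
qed

section \<open>Quotients by homogeneous ideals\<close>

locale graded_ideal =
  fixes n :: nat and I :: "cpoly set"
  assumes ideal: "ideal I (poly_ring n)"
    and hom_part_closed: "p \<in> I \<Longrightarrow> hom_part d p \<in> I"
begin

interpretation ideal I "poly_ring n" by (rule ideal)

lemma ideal_zero: "0 \<in> I"
  using additive_subgroup.zero_closed[OF is_additive_subgroup] by simp

lemma ideal_add: "p \<in> I \<Longrightarrow> q \<in> I \<Longrightarrow> p + q \<in> I"
  using additive_subgroup.a_closed[OF is_additive_subgroup, of p q] by simp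

lemma ideal_mult: "p \<in> carrier (poly_ring n) \<Longrightarrow> q \<in> I \<Longrightarrow> p * q \<in> I"
  using I_l_closed[of q p] by simp

lemma ideal_uminus: "p \<in> I \<Longrightarrow> - p \<in> I"
  using ideal_mult[OF poly_ring_uminus[OF poly_ring_one], of p] by simp

lemma ideal_diff: "p \<in> I \<Longrightarrow> q \<in> I \<Longrightarrow> p - q \<in> I"
  using ideal_add[of p "- q"] ideal_uminus[of q] by simp

lemma coset_mem: "q \<in> I +>\<^bsub>poly_ring n\<^esub> p \<longleftrightarrow> q - p \<in> I"
proof
  assume "q \<in> I +>\<^bsub>poly_ring n\<^esub> p"
  then show "q - p \<in> I" by (auto simp: a_r_coset_def')
next
  assume "q - p \<in> I"
  moreover have "q = (q - p) + p" by simp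
  ultimately show "q \<in> I +>\<^bsub>poly_ring n\<^esub> p" unfolding a_r_coset_def' by fastforce
qed

lemma coset_eq_iff: "I +>\<^bsub>poly_ring n\<^esub> p = I +>\<^bsub>poly_ring n\<^esub> q \<longleftrightarrow> p - q \<in> I"
proof
  assume "I +>\<^bsub>poly_ring n\<^esub> p = I +>\<^bsub>poly_ring n\<^esub> q"
  moreover have "p \<in> I +>\<^bsub>poly_ring n\<^esub> p" by (simp add: coset_mem ideal_zero)
  ultimately show "p - q \<in> I" by (simp add: coset_mem)
next
  assume pq: "p - q \<in> I"
  have "r - p \<in> I \<longleftrightarrow> r - q \<in> I" for r
    using ideal_add[OF _ pq, of "r - p"] ideal_diff[OF _ pq, of "r - q"] by auto
  then show "I +>\<^bsub>poly_ring n\<^esub> p = I +>\<^bsub>poly_ring n\<^esub> q" by (auto simp: coset_mem)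
qed

text \<open>Scalar multiplication, projections to homogeneous parts and induced maps on quotients are
  unions of cosets over representatives; such a union is a single coset as soon as the map \<open>F\<close>
  respects congruence.  The target ideal may live in another polynomial ring, as it does for
  pullbacks.\<close>

lemma coset_union:
  assumes J: "graded_ideal m J" and F: "\<And>q. q - p \<in> I \<Longrightarrow> F q - F p \<in> J"
  shows "(\<Union>q\<in>I +>\<^bsub>poly_ring n\<^esub> p. J +>\<^bsub>poly_ring m\<^esub> F q) = J +>\<^bsub>poly_ring m\<^esub> F p"
proof -
  have "J +>\<^bsub>poly_ring m\<^esub> F q = J +>\<^bsub>poly_ring m\<^esub> F p" if "q \<in> I +>\<^bsub>poly_ring n\<^esub> p" for q
    using that F by (simp add: coset_mem graded_ideal.coset_eq_iff[OF J])
  moreover have "p \<in> I +>\<^bsub>poly_ring n\<^esub> p" by (simp add: coset_mem ideal_zero)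
  ultimately show ?thesis by blast
qed

abbreviation Q where "Q \<equiv> algebra_quot (poly_ring n) I"

lemma quot_carrier: "carrier Q = (\<lambda>p. I +>\<^bsub>poly_ring n\<^esub> p) ` carrier (poly_ring n)"
  by (auto simp: algebra_quot_def FactRing_def A_RCOSETS_def' a_r_coset_def')

lemma quot_mem: "p \<in> carrier (poly_ring n) \<Longrightarrow> I +>\<^bsub>poly_ring n\<^esub> p \<in> carrier Q"
  by (auto simp: quot_carrier)

lemma quot_add:
  assumes "p \<in> carrier (poly_ring n)" "q \<in> carrier (poly_ring n)"
  shows "(I +>\<^bsub>poly_ring n\<^esub> p) \<oplus>\<^bsub>Q\<^esub> (I +>\<^bsub>poly_ring n\<^esub> q) = I +>\<^bsub>poly_ring n\<^esub> (p + q)"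
  using a_rcos_sum[OF assms] by (simp add: algebra_quot_def FactRing_def)

lemma quot_zero: "\<zero>\<^bsub>Q\<^esub> = I +>\<^bsub>poly_ring n\<^esub> 0"
  by (simp add: algebra_quot_def FactRing_def set_eq_iff coset_mem)

lemma quot_smult:
  "c \<odot>\<^bsub>Q\<^esub> (I +>\<^bsub>poly_ring n\<^esub> p) = I +>\<^bsub>poly_ring n\<^esub> (poly_const c * p)"
proof -
  have "poly_const c * q - poly_const c * p \<in> I" if "q - p \<in> I" for q
    using ideal_mult[OF poly_ring_const that, of c] by (simp add: right_diff_distrib)
  then show ?thesis
    using coset_union[OF graded_ideal_axioms, of p "\<lambda>p. poly_const c * p"]
    by (simp add: algebra_quot_def)
qed

lemma quot_module: "module complex_field Q"
proof (rule moduleI)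
  show "cring complex_field" by (rule cring_complex_field)
  show "abelian_group Q"
  proof (rule abelian_groupI)
    fix x assume "x \<in> carrier Q"
    then obtain p where p: "p \<in> carrier (poly_ring n)" "x = I +>\<^bsub>poly_ring n\<^esub> p"
      by (auto simp: quot_carrier)
    then show "\<exists>y\<in>carrier Q. y \<oplus>\<^bsub>Q\<^esub> x = \<zero>\<^bsub>Q\<^esub>"
      by (intro bexI[of _ "I +>\<^bsub>poly_ring n\<^esub> (- p)"])
        (auto simp: quot_add quot_zero quot_mem poly_ring_closed)
  qed (auto simp: quot_carrier quot_add quot_zero poly_ring_closed add_ac)
qed (auto simp: quot_carrier quot_add quot_smult poly_ring_closed poly_const_simps algebra_simps)

lemma quot_finsum:
  assumes "finite D" "\<And>d. g d \<in> carrier (poly_ring n)"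
  shows "(\<Oplus>\<^bsub>Q\<^esub>d\<in>D. I +>\<^bsub>poly_ring n\<^esub> g d) = I +>\<^bsub>poly_ring n\<^esub> (\<Sum>d\<in>D. g d)"
proof -
  interpret Q: module complex_field Q by (rule quot_module)
  show ?thesis using assms(1)
    by (induction D rule: finite_induct)
      (auto simp: assms(2) quot_zero quot_mem quot_add poly_ring_sum)
qed

abbreviation quot_grading where
  "quot_grading d \<equiv> (\<lambda>p. I +>\<^bsub>poly_ring n\<^esub> p) ` homogeneous_polys n d"

lemma homogeneous_carrier: "p \<in> homogeneous_polys n d \<Longrightarrow> p \<in> carrier (poly_ring n)"
  by (simp add: homogeneous_polys_def)

lemma quot_grading_submodule: "submodule (quot_grading d) complex_field Q"
proof -
  interpret Q: module complex_field Q by (rule quot_module)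
  have "0 \<in> homogeneous_polys n d" by (simp add: homogeneous_polys_iff)
  moreover have add: "p + q \<in> homogeneous_polys n d"
    if "p \<in> homogeneous_polys n d" "q \<in> homogeneous_polys n d" for p q
    using that keys_add[of p q] by (auto simp: homogeneous_polys_iff)
  moreover have smult: "poly_const c * p \<in> homogeneous_polys n d" if "p \<in> homogeneous_polys n d" for p c
    using that keys_mult[of "poly_const c" p]
    by (auto simp: homogeneous_polys_iff poly_const_def split: if_splits)
  ultimately have closed: "\<zero>\<^bsub>Q\<^esub> \<in> quot_grading d"
    "\<And>x y. x \<in> quot_grading d \<Longrightarrow> y \<in> quot_grading d \<Longrightarrow> x \<oplus>\<^bsub>Q\<^esub> y \<in> quot_grading d"
    "\<And>x c. x \<in> quot_grading d \<Longrightarrow> c \<odot>\<^bsub>Q\<^esub> x \<in> quot_grading d"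
    by (auto simp: quot_zero quot_add quot_smult homogeneous_carrier)
  show ?thesis
  proof (rule Q.submoduleI)
    show "quot_grading d \<subseteq> carrier Q" by (auto simp: quot_carrier homogeneous_carrier)
    fix x assume x: "x \<in> quot_grading d"
    then obtain p where p: "p \<in> homogeneous_polys n d" "x = I +>\<^bsub>poly_ring n\<^esub> p" by auto
    note pc = homogeneous_carrier[OF p(1)]
    have "\<ominus>\<^bsub>Q\<^esub> x = I +>\<^bsub>poly_ring n\<^esub> (- p)"
      by (rule abelian_group.minus_equality)
        (use Q.abelian_group_axioms pc p in \<open>auto simp: quot_add quot_zero quot_mem poly_ring_closed\<close>)
    also have "- p \<in> homogeneous_polys n d"
      using p(1) by (simp add: homogeneous_polys_iff)
    then have "I +>\<^bsub>poly_ring n\<^esub> (- p) \<in> quot_grading d" by blast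
    finally show "\<ominus>\<^bsub>Q\<^esub> x \<in> quot_grading d" .
  qed (use closed in auto)
qed

lemma quot_graded: "graded_vector_space Q quot_grading"
proof -
  define \<pi> where "\<pi> d X = (\<Union>p\<in>X. I +>\<^bsub>poly_ring n\<^esub> hom_part d p)" for d X
  have \<pi>: "\<pi> d (I +>\<^bsub>poly_ring n\<^esub> p) = I +>\<^bsub>poly_ring n\<^esub> hom_part d p" for d p
    unfolding \<pi>_def
    by (rule coset_union[OF graded_ideal_axioms]) (simp add: hom_part_diff[symmetric] hom_part_closed)
  note carr = homogeneous_carrier[OF hom_part_mem]
  have fin: "finite {d. I +>\<^bsub>poly_ring n\<^esub> hom_part d p \<noteq> \<zero>\<^bsub>Q\<^esub>}" for p
    by (rule finite_subset[OF _ finite_hom_parts[of p]]) (auto simp: quot_zero)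
  show ?thesis
  proof (rule graded_vector_spaceI[where \<pi> = \<pi>])
    show "module complex_field Q" by (rule quot_module)
    show "submodule (quot_grading d) complex_field Q" for d by (rule quot_grading_submodule)
    show "\<pi> d x \<in> quot_grading d" if "x \<in> carrier Q" for d x
      using that by (auto simp: quot_carrier \<pi> hom_part_mem)
    show "\<pi> d (x \<oplus>\<^bsub>Q\<^esub> y) = \<pi> d x \<oplus>\<^bsub>Q\<^esub> \<pi> d y" if "x \<in> carrier Q" "y \<in> carrier Q" for d x y
      using that by (auto simp: quot_carrier \<pi> quot_add hom_part_add carr)
    show "\<pi> d x = x" if "x \<in> quot_grading d" for d x
      using that by (auto simp: \<pi> hom_part_homogeneous)
    show "\<pi> d x = \<zero>\<^bsub>Q\<^esub>" if "x \<in> quot_grading e" "e \<noteq> d" for d e x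
      using that by (auto simp: \<pi> hom_part_homogeneous quot_zero)
    fix x assume "x \<in> carrier Q"
    then obtain p where p: "p \<in> carrier (poly_ring n)" "x = I +>\<^bsub>poly_ring n\<^esub> p"
      by (auto simp: quot_carrier)
    show "finite {d. \<pi> d x \<noteq> \<zero>\<^bsub>Q\<^esub>}" unfolding p(2) \<pi> by (rule fin)
    interpret Q: module complex_field Q by (rule quot_module)
    let ?D = "{d. hom_part d p \<noteq> 0}"
    have "x = I +>\<^bsub>poly_ring n\<^esub> (\<Sum>d\<in>?D. hom_part d p)"
      using sum_hom_parts[OF finite_hom_parts order_refl, of p] p(2) by simp
    also have "\<dots> = (\<Oplus>\<^bsub>Q\<^esub>d\<in>?D. I +>\<^bsub>poly_ring n\<^esub> hom_part d p)"
      by (rule quot_finsum[symmetric]) (use finite_hom_parts carr[OF p(1)] in auto)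
    also have "\<dots> = (\<Oplus>\<^bsub>Q\<^esub>d\<in>{d. \<pi> d x \<noteq> \<zero>\<^bsub>Q\<^esub>}. \<pi> d x)"
      unfolding p(2) \<pi>
      by (rule Q.finsum_support[symmetric])
        (use finite_hom_parts carr[OF p(1)] in \<open>auto simp: quot_zero quot_mem\<close>)
    finally show "x = (\<Oplus>\<^bsub>Q\<^esub>d\<in>{d. \<pi> d x \<noteq> \<zero>\<^bsub>Q\<^esub>}. \<pi> d x)" .
  qed
qed

end

text \<open>Systems of homogeneous ideals that are compatible with the co-FI structure.  The quotients,
  gradings and induced maps are parameters determined at positive indices only, since the objects
  of FI are the sets \<open>{1..n}\<close> with \<open>n \<ge> 1\<close>, while the families are functions on all of
  \<^typ>\<open>nat\<close>.\<close>

locale stable_ideals =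
  fixes I :: "nat \<Rightarrow> cpoly set"
    and V :: "nat \<Rightarrow> (complex, cpoly set) module"
    and G :: "nat \<Rightarrow> nat \<Rightarrow> cpoly set set"
    and act :: "nat \<Rightarrow> nat \<Rightarrow> (nat \<Rightarrow> nat) \<Rightarrow> cpoly set \<Rightarrow> cpoly set"
  assumes graded_ideal: "1 \<le> n \<Longrightarrow> graded_ideal n (I n)"
    and stable: "1 \<le> m \<Longrightarrow> 1 \<le> n \<Longrightarrow> f \<in> fi_hom m n \<Longrightarrow> p \<in> I n \<Longrightarrow> poly_pullback m f p \<in> I m"
    and V: "1 \<le> n \<Longrightarrow> V n = algebra_quot (poly_ring n) (I n)"
    and G: "1 \<le> n \<Longrightarrow> G n d = (\<lambda>p. I n +>\<^bsub>poly_ring n\<^esub> p) ` homogeneous_polys n d"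
    and act: "1 \<le> m \<Longrightarrow> act m n f X = (\<Union>p\<in>X. I m +>\<^bsub>poly_ring m\<^esub> poly_pullback m f p)"
begin

lemma inj: "f \<in> fi_hom m n \<Longrightarrow> inj_on f {1..m}"
  by (simp add: fi_hom_def)

lemma act_coset:
  assumes "1 \<le> m" "1 \<le> n" "f \<in> fi_hom m n"
  shows "act m n f (I n +>\<^bsub>poly_ring n\<^esub> p) = I m +>\<^bsub>poly_ring m\<^esub> poly_pullback m f p"
  unfolding act[OF assms(1)]
  by (rule graded_ideal.coset_union[OF graded_ideal[OF assms(2)] graded_ideal[OF assms(1)]])
    (simp add: pullback_diff[symmetric] stable[OF assms])

lemma carrier_V: "1 \<le> n \<Longrightarrow> carrier (V n) = (\<lambda>p. I n +>\<^bsub>poly_ring n\<^esub> p) ` carrier (poly_ring n)"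
  by (simp add: V graded_ideal.quot_carrier[OF graded_ideal])

lemma quotient_graded_cofi_module: "graded_cofi_module V G act"
proof (intro graded_cofi_module.intro cofi_module.intro graded_cofi_module_axioms.intro)
  show "module complex_field (V n)" if "1 \<le> n" for n
    using graded_ideal.quot_module[OF graded_ideal[OF that]] V[OF that] by simp
  show "act m n f \<in> lin_hom (V n) (V m)" if mnf: "1 \<le> m" "1 \<le> n" "f \<in> fi_hom m n" for m n f
  proof -
    note gn = graded_ideal[OF mnf(2)] and gm = graded_ideal[OF mnf(1)]
    note carr = pullback_carrier[OF inj[OF mnf(3)]]
    show ?thesis
      by (auto simp: lin_hom_def graded_ideal.quot_carrier[OF gn] graded_ideal.quot_carrier[OF gm] act_coset[OF mnf] carr
          V[OF mnf(1)] V[OF mnf(2)] poly_ring_closed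
          graded_ideal.quot_add[OF gn] graded_ideal.quot_add[OF gm]
          graded_ideal.quot_smult[OF gn] graded_ideal.quot_smult[OF gm]
          pullback_add pullback_mult[OF inj[OF mnf(3)]] pullback_const[OF inj[OF mnf(3)]])
  qed
  show "act n n (fi_id n) x = x" if "1 \<le> n" "x \<in> carrier (V n)" for n x
  proof -
    have "fi_id n \<in> fi_hom n n" by (auto simp: fi_id_def fi_hom_def inj_on_def)
    then show ?thesis using that by (auto simp: carrier_V act_coset pullback_id)
  qed
  show "act l n (fi_comp l g f) x = act l m f (act m n g x)"
    if "1 \<le> l" "1 \<le> m" "1 \<le> n" "f \<in> fi_hom l m" "g \<in> fi_hom m n" "x \<in> carrier (V n)" for l m n f g x
  proof -
    have "fi_comp l g f \<in> fi_hom l n" by (rule fi_comp_mem[OF that(4,5)])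
    then show ?thesis using that by (auto simp: carrier_V act_coset pullback_comp)
  qed
  show "graded_vector_space (V n) (G n)" if "1 \<le> n" for n
  proof -
    have "G n = (\<lambda>d. (\<lambda>p. I n +>\<^bsub>poly_ring n\<^esub> p) ` homogeneous_polys n d)"
      using G[OF that] by blast
    then show ?thesis
      using graded_ideal.quot_graded[OF graded_ideal[OF that]] V[OF that] by simp
  qed
  show "act m n f ` G n d \<subseteq> G m d" if mnf: "1 \<le> m" "1 \<le> n" "f \<in> fi_hom m n" for m n f d
    by (auto simp: G[OF mnf(1)] G[OF mnf(2)] act_coset[OF mnf] pullback_homogeneous[OF inj[OF mnf(3)]])
qed

text \<open>The coefficient of a functional at a monomial is its value on the class of that monomial.
  A functional that is homogeneous of degree \<open>d\<close> vanishes on classes of monomials of other degrees,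
  so its coefficients in degree \<open>d\<close> determine it.\<close>

theorem quotient_finite_type: "cofi_finite_type V G act"
proof -
  interpret graded_cofi_module V G act by (rule quotient_graded_cofi_module)
  let ?V = "\<lambda>n. graded_dual (V n) (G n)" and ?G = "\<lambda>n. dual_grading (V n) (G n)"
  interpret dual: graded_fi_module ?V ?G "dual_act V act" by (rule dual_graded_fi_module)
  have "finitely_generated_fi_module (\<lambda>n. (?V n)\<lparr>carrier := ?G n d\<rparr>) (dual_act V act)" for d
  proof (rule finitely_generated_by_leading_monomials[where d = d and
        \<kappa> = "\<lambda>n \<phi> u. \<phi> (I n +>\<^bsub>poly_ring n\<^esub> Poly_Mapping.single u 1)"])
    show "fi_module (\<lambda>n. (?V n)\<lparr>carrier := ?G n d\<rparr>) (dual_act V act)"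
      by (rule dual.graded_part_fi_module)
    have mon: "I n +>\<^bsub>poly_ring n\<^esub> Poly_Mapping.single u 1 \<in> carrier (V n)"
      if "1 \<le> n" "u \<in> monomials n d" for n u
      using that by (auto simp: carrier_V monomials_def intro!: imageI poly_ring_single)
    have dual_zero: "\<phi> (I n +>\<^bsub>poly_ring n\<^esub> 0) = 0"
      if "1 \<le> n" "\<phi> \<in> ?G n d" for n \<phi>
    proof -
      have "\<phi> \<zero>\<^bsub>V n\<^esub> = 0"
        by (rule graded_vector_space.graded_dual_zero[OF graded[OF that(1)]])
          (use that in \<open>simp add: dual_grading_def\<close>)
      then show ?thesis
        unfolding V[OF that(1)] graded_ideal.quot_zero[OF graded_ideal[OF that(1)]] .
    qed
    show "(\<phi> \<oplus>\<^bsub>(?V n)\<lparr>carrier := ?G n d\<rparr>\<^esub> \<psi>) (I n +>\<^bsub>poly_ring n\<^esub> Poly_Mapping.single u 1) =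
      \<phi> (I n +>\<^bsub>poly_ring n\<^esub> Poly_Mapping.single u 1) + \<psi> (I n +>\<^bsub>poly_ring n\<^esub> Poly_Mapping.single u 1)"
      if "1 \<le> n" "u \<in> monomials n d" for n u \<phi> \<psi>
      using mon[OF that] by simp
    show "(c \<odot>\<^bsub>(?V n)\<lparr>carrier := ?G n d\<rparr>\<^esub> \<phi>) (I n +>\<^bsub>poly_ring n\<^esub> Poly_Mapping.single u 1) =
      c * \<phi> (I n +>\<^bsub>poly_ring n\<^esub> Poly_Mapping.single u 1)"
      if "1 \<le> n" "u \<in> monomials n d" for n u c \<phi>
      using mon[OF that] by simp
    show "dual_act V act m n f \<phi> (I n +>\<^bsub>poly_ring n\<^esub> Poly_Mapping.single v 1) =
      (if Poly_Mapping.keys v \<subseteq> f ` {1..m}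
       then \<phi> (I m +>\<^bsub>poly_ring m\<^esub> Poly_Mapping.single (pull_mon m f v) 1) else 0)"
      if mnf: "1 \<le> m" "1 \<le> n" "f \<in> fi_hom m n" and "\<phi> \<in> carrier ((?V m)\<lparr>carrier := ?G m d\<rparr>)"
        "v \<in> monomials n d" for m n f \<phi> v
    proof -
      have "dual_act V act m n f \<phi> (I n +>\<^bsub>poly_ring n\<^esub> Poly_Mapping.single v 1) =
        \<phi> (I m +>\<^bsub>poly_ring m\<^esub> poly_pullback m f (Poly_Mapping.single v 1))"
        using mon[OF mnf(2) \<open>v \<in> monomials n d\<close>] by (simp add: dual_act_def act_coset[OF mnf])
      then show ?thesis
        unfolding pullback_single[OF inj[OF mnf(3)]] using dual_zero[OF mnf(1), of \<phi>] that(4) by simp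
    qed
    show "\<phi> = \<zero>\<^bsub>(?V n)\<lparr>carrier := ?G n d\<rparr>\<^esub>"
      if n: "1 \<le> n" and "\<phi> \<in> carrier ((?V n)\<lparr>carrier := ?G n d\<rparr>)"
        and vanish: "\<And>u. u \<in> monomials n d \<Longrightarrow> \<phi> (I n +>\<^bsub>poly_ring n\<^esub> Poly_Mapping.single u 1) = 0"
      for n \<phi>
    proof -
      have \<phi>: "\<phi> \<in> ?G n d" using that(2) by simp
      then have dual: "\<phi> \<in> carrier (?V n)" by (simp add: dual_grading_def)
      note gn = graded_ideal[OF n]
      have "\<phi> (I n +>\<^bsub>poly_ring n\<^esub> p) = 0" if "p \<in> carrier (poly_ring n)" for p
        using that unfolding poly_ring_carrier
      proof (induction p rule: poly_mapping_keys_induct)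
        case zero
        show ?case by (rule dual_zero[OF n \<phi>])
      next
        case (single u c)
        then have u: "Poly_Mapping.single u 1 \<in> carrier (poly_ring n)"
          by (intro poly_ring_single) simp
        have "\<phi> (I n +>\<^bsub>poly_ring n\<^esub> Poly_Mapping.single u 1) = 0"
        proof (cases "mon_degree u = d")
          case True
          then show ?thesis using single by (intro vanish) (simp add: monomials_def)
        next
          case False
          have "I n +>\<^bsub>poly_ring n\<^esub> Poly_Mapping.single u 1 \<in> G n (mon_degree u)"
            using single by (auto simp: G[OF n] homogeneous_polys_iff monomials_def intro!: imageI)
          then show ?thesis using \<phi> False by (auto simp: dual_grading_def)
        qed
        moreover have "I n +>\<^bsub>poly_ring n\<^esub> Poly_Mapping.single u c =
          c \<odot>\<^bsub>V n\<^esub> (I n +>\<^bsub>poly_ring n\<^esub> Poly_Mapping.single u 1)"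
          by (simp add: V[OF n] graded_ideal.quot_smult[OF gn] poly_const_single)
        moreover have "I n +>\<^bsub>poly_ring n\<^esub> Poly_Mapping.single u 1 \<in> carrier (V n)"
          using u by (simp add: carrier_V[OF n])
        ultimately show ?case using graded_dual_memD(3)[OF dual] by simp
      next
        case (add p q)
        then have pq: "p \<in> carrier (poly_ring n)" "q \<in> carrier (poly_ring n)"
          by (simp_all add: poly_ring_carrier)
        then have "I n +>\<^bsub>poly_ring n\<^esub> (p + q) = (I n +>\<^bsub>poly_ring n\<^esub> p) \<oplus>\<^bsub>V n\<^esub> (I n +>\<^bsub>poly_ring n\<^esub> q)"
          by (simp add: V[OF n] graded_ideal.quot_add[OF gn])
        moreover have "I n +>\<^bsub>poly_ring n\<^esub> p \<in> carrier (V n)" "I n +>\<^bsub>poly_ring n\<^esub> q \<in> carrier (V n)"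
          using pq by (simp_all add: carrier_V[OF n])
        ultimately show ?case using graded_dual_memD(2)[OF dual] add.IH by simp
      qed
      then have "\<phi> x = 0" if "x \<in> carrier (V n)" for x
        using that by (auto simp: carrier_V[OF n])
      then have "\<phi> = (\<lambda>x\<in>carrier (V n). 0)"
        by (intro extensionalityI[OF graded_dual_memD(1)[OF dual] restrict_extensional]) simp
      then show ?thesis by simp
    qed
  qed
  then show ?thesis
    unfolding cofi_finite_type_def fi_finite_type_def
    using graded_cofi_module_axioms dual.graded_fi_module_axioms by blast
qed

end

lemma poly_ring_idealI:
  assumes "J \<subseteq> carrier (poly_ring n)" "0 \<in> J" "\<And>p q. p \<in> J \<Longrightarrow> q \<in> J \<Longrightarrow> p + q \<in> J"
    and mult: "\<And>p q. p \<in> carrier (poly_ring n) \<Longrightarrow> q \<in> J \<Longrightarrow> p * q \<in> J"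
  shows "ideal J (poly_ring n)"
proof (rule idealI)
  interpret cring "poly_ring n" by (rule poly_ring_cring)
  show "ring (poly_ring n)" by (rule ring_axioms)
  show "subgroup J (add_monoid (poly_ring n))"
  proof (rule add.subgroupI)
    fix p assume p: "p \<in> J"
    then have "\<ominus>\<^bsub>poly_ring n\<^esub> p = - p"
      by (intro minus_equality) (use assms(1) in \<open>auto simp: poly_ring_uminus\<close>)
    moreover have "- p \<in> J" using mult[of "- 1" p] p by (simp add: poly_ring_closed)
    ultimately show "\<ominus>\<^bsub>poly_ring n\<^esub> p \<in> J" by simp
  qed (use assms in auto)
  show "p \<otimes>\<^bsub>poly_ring n\<^esub> q \<in> J" if "p \<in> J" "q \<in> carrier (poly_ring n)" for p q
    using mult[OF that(2,1)] by (simp add: mult.commute)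
qed (use mult in simp)

text \<open>The elements of the ideal whose homogeneous parts all lie in the ideal form an ideal
  themselves, and it contains the homogeneous generators.\<close>

lemma genideal_graded_ideal:
  assumes S: "S \<subseteq> (\<Union>d. homogeneous_polys n d)"
  shows "graded_ideal n (genideal (poly_ring n) S)"
proof -
  interpret R: cring "poly_ring n" by (rule poly_ring_cring)
  let ?I = "genideal (poly_ring n) S"
  have Sc: "S \<subseteq> carrier (poly_ring n)" using S by (auto simp: homogeneous_polys_def)
  interpret I: ideal ?I "poly_ring n" by (rule R.genideal_ideal[OF Sc])
  have zero: "0 \<in> ?I" using additive_subgroup.zero_closed[OF I.is_additive_subgroup] by simp
  have add: "p + q \<in> ?I" if "p \<in> ?I" "q \<in> ?I" for p q
    using additive_subgroup.a_closed[OF I.is_additive_subgroup that] by simp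
  have mult: "p * q \<in> ?I" if "p \<in> carrier (poly_ring n)" "q \<in> ?I" for p q
    using I.I_l_closed[OF that(2,1)] by simp
  define J where "J = {p \<in> ?I. \<forall>d. hom_part d p \<in> ?I}"
  have "ideal J (poly_ring n)"
  proof (rule poly_ring_idealI)
    show "J \<subseteq> carrier (poly_ring n)" using I.a_subset by (auto simp: J_def)
    fix p q assume p: "p \<in> carrier (poly_ring n)" and q: "q \<in> J"
    have "hom_part d (p * q) \<in> ?I" for d
      using p unfolding poly_ring_carrier
    proof (induction p rule: poly_mapping_keys_induct)
      case (single u c)
      then show ?case
        using q by (auto simp: hom_part_single_mult J_def zero intro!: mult poly_ring_single)
    qed (simp_all add: zero add distrib_right hom_part_add)
    then show "p * q \<in> J" using p q mult by (simp add: J_def)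
  qed (auto simp: J_def zero add hom_part_add)
  moreover have "S \<subseteq> J"
    using S R.genideal_self[OF Sc] by (auto simp: J_def hom_part_homogeneous zero subset_iff)
  ultimately have "?I \<subseteq> J" by (rule R.genideal_minimal)
  then show ?thesis
    using I.ideal_axioms by (auto simp: graded_ideal_def J_def)
qed

section \<open>Elementary symmetric polynomials\<close>

lemma prod_poly_var: "finite T \<Longrightarrow> (\<Prod>j\<in>T. poly_var j) =
    Poly_Mapping.single (\<Sum>j\<in>T. Poly_Mapping.single j 1) 1"
  using prod_poly_var_power[of T "\<lambda>_. 1"] by simp

lemma elem_sym_homogeneous:
  assumes "S \<subseteq> {1..n}"
  shows "elem_sym i S \<in> homogeneous_polys n i"
proof -
  have "(\<Prod>j\<in>T. poly_var j) \<in> homogeneous_polys n i" if T: "T \<subseteq> S" "card T = i" for T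
  proof -
    have fin: "finite T" using T assms by (meson finite_atLeastAtMost finite_subset)
    let ?u = "\<Sum>j\<in>T. Poly_Mapping.single j (1::nat)"
    have lookup: "Poly_Mapping.lookup ?u j = (if j \<in> T then 1 else 0)" for j
      using fin by (simp add: lookup_sum lookup_single when_def)
    then have keys: "Poly_Mapping.keys ?u = T" by (auto simp: in_keys_iff split: if_splits)
    have "mon_degree ?u = (\<Sum>j\<in>T. 1)"
      unfolding mon_degree_def keys by (rule sum.cong) (simp_all only: lookup if_True)
    then have "mon_degree ?u = i" using T(2) by simp
    then have "?u \<in> monomials n i" using keys T assms by (auto simp: monomials_def)
    then show ?thesis by (simp add: homogeneous_polys_iff prod_poly_var[OF fin])
  qed
  then show ?thesis
    unfolding elem_sym_def homogeneous_polys_iff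
    by (intro order_trans[OF keys_sum]) blast
qed

lemma elem_sym_eq_0:
  assumes "finite S" "card S < i"
  shows "elem_sym i S = 0"
proof -
  have "{T. T \<subseteq> S \<and> card T = i} = {}"
    using assms card_mono by (fastforce simp: not_le[symmetric])
  then show ?thesis unfolding elem_sym_def by (simp only: sum.empty)
qed

text \<open>Double counting: a monomial of \<open>e\<^sub>i(S)\<close> survives the removal of \<open>x\<close> for each of the
  \<open>|S| - i\<close> elements \<open>x\<close> that it does not involve.\<close>

lemma sum_elem_sym_remove:
  assumes "finite S"
  shows "(\<Sum>x\<in>S. elem_sym i (S - {x})) = of_nat (card S - i) * elem_sym i S"
proof -
  let ?A = "{T. T \<subseteq> S \<and> card T = i}"
  have fin: "finite ?A" using assms by simp
  have "(\<Sum>x\<in>S. elem_sym i (S - {x})) = (\<Sum>x\<in>S. \<Sum>T\<in>{T. T \<in> ?A \<and> x \<notin> T}. \<Prod>j\<in>T. poly_var j)"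
    unfolding elem_sym_def by (intro sum.cong refl) auto
  also have "\<dots> = (\<Sum>T\<in>?A. \<Sum>x\<in>{x. x \<in> S \<and> x \<notin> T}. \<Prod>j\<in>T. poly_var j)"
    by (rule sum.swap_restrict[OF assms fin])
  also have "\<dots> = (\<Sum>T\<in>?A. of_nat (card S - i) * (\<Prod>j\<in>T. poly_var j))"
  proof (rule sum.cong[OF refl])
    fix T assume T: "T \<in> ?A"
    then have "card {x. x \<in> S \<and> x \<notin> T} = card S - i"
      using card_Diff_subset[of T S] finite_subset[OF _ assms] by (auto simp: set_diff_eq)
    then show "(\<Sum>x\<in>{x. x \<in> S \<and> x \<notin> T}. \<Prod>j\<in>T. poly_var j) =
        of_nat (card S - i) * (\<Prod>j\<in>T. poly_var j)" by simp
  qed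
  finally show ?thesis by (simp add: elem_sym_def sum_distrib_left)
qed

lemma pullback_var:
  assumes inj: "inj_on f {1..m}"
  shows "poly_pullback m f (poly_var j) =
    (if j \<in> f ` {1..m} then poly_var (the_inv_into {1..m} f j) else 0)"
  by (simp add: poly_pullback_def poly_var_def poly_subst_single poly_const_simps)

text \<open>The subsets of \<open>S\<close> that reach outside the image of \<open>f\<close> contribute 0; the others are the images of
  the subsets of the preimage of \<open>S\<close>.\<close>

lemma pullback_elem_sym:
  assumes f: "f \<in> fi_hom m n" and S: "finite S"
  shows "poly_pullback m f (elem_sym i S) = elem_sym i {k\<in>{1..m}. f k \<in> S}"
proof -
  have inj: "inj_on f {1..m}" using f by (simp add: fi_hom_def)
  let ?P = "{k\<in>{1..m}. f k \<in> S}"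
  let ?A = "{T. T \<subseteq> S \<and> card T = i}" and ?B = "{T. T \<subseteq> ?P \<and> card T = i}"
  have fin: "finite ?A" using S by simp
  have "poly_pullback m f (elem_sym i S) = (\<Sum>T\<in>?A. \<Prod>j\<in>T. poly_pullback m f (poly_var j))"
    by (simp add: elem_sym_def pullback_sum pullback_prod[OF inj])
  also have "\<dots> = (\<Sum>T\<in>{T\<in>?A. T \<subseteq> f ` {1..m}}. \<Prod>j\<in>T. poly_pullback m f (poly_var j))"
  proof (rule sum.mono_neutral_right[OF fin])
    show "\<forall>T\<in>?A - {T\<in>?A. T \<subseteq> f ` {1..m}}. (\<Prod>j\<in>T. poly_pullback m f (poly_var j)) = 0"
    proof
      fix T assume T: "T \<in> ?A - {T\<in>?A. T \<subseteq> f ` {1..m}}"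
      then obtain j where "j \<in> T" "j \<notin> f ` {1..m}" by blast
      moreover have "finite T" using T S finite_subset by auto
      ultimately show "(\<Prod>j\<in>T. poly_pullback m f (poly_var j)) = 0"
        using pullback_var[OF inj, of j] by (intro prod_zero bexI[of _ j]) simp_all
    qed
  qed auto
  also have "{T\<in>?A. T \<subseteq> f ` {1..m}} = (\<lambda>T. f ` T) ` ?B"
  proof (intro equalityI subsetI)
    fix T assume T: "T \<in> {T\<in>?A. T \<subseteq> f ` {1..m}}"
    then obtain U where U: "U \<subseteq> {1..m}" "T = f ` U" by (auto simp: subset_image_iff)
    have "card U = i" using T U card_image[OF inj_on_subset[OF inj U(1)]] by simp
    then have "U \<in> ?B" using T U by auto
    then show "T \<in> (\<lambda>T. f ` T) ` ?B" using U by blast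
  next
    fix T assume "T \<in> (\<lambda>T. f ` T) ` ?B"
    then obtain U where U: "U \<in> ?B" "T = f ` U" by blast
    then have "inj_on f U" by (intro inj_on_subset[OF inj]) auto
    then show "T \<in> {T\<in>?A. T \<subseteq> f ` {1..m}}" using U by (auto simp: card_image)
  qed
  also have "(\<Sum>T\<in>(\<lambda>T. f ` T) ` ?B. \<Prod>j\<in>T. poly_pullback m f (poly_var j)) =
      (\<Sum>U\<in>?B. \<Prod>j\<in>f ` U. poly_pullback m f (poly_var j))"
  proof (rule sum.reindex[unfolded comp_def])
    show "inj_on ((`) f) ?B"
      by (rule inj_on_subset[OF inj_on_image_Pow[OF inj]]) auto
  qed
  also have "\<dots> = elem_sym i ?P"
    unfolding elem_sym_def
  proof (rule sum.cong[OF refl])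
    fix U assume U: "U \<in> ?B"
    have "(\<Prod>j\<in>f ` U. poly_pullback m f (poly_var j)) = (\<Prod>k\<in>U. poly_pullback m f (poly_var (f k)))"
      using U by (intro prod.reindex[unfolded comp_def] inj_on_subset[OF inj]) auto
    also have "\<dots> = (\<Prod>k\<in>U. poly_var k)"
    proof (rule prod.cong[OF refl])
      fix k assume "k \<in> U"
      then have "k \<in> {1..m}" using U by auto
      then show "poly_pullback m f (poly_var (f k)) = poly_var k"
        using the_inv_into_f_f[OF inj, of k] by (simp add: pullback_var[OF inj])
    qed
    finally show "(\<Prod>j\<in>f ` U. poly_pullback m f (poly_var j)) = (\<Prod>k\<in>U. poly_var k)" .
  qed
  finally show ?thesis .
qed

section \<open>Tanisaki ideals\<close>

text \<open>The subtraction truncates, so columns beyond the diagram contribute 0.  This keeps the count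
  monotone in the column index as well as in the partition.\<close>

definition below_top :: "(nat \<Rightarrow> nat) \<Rightarrow> nat \<Rightarrow> nat" where
  "below_top lam c = (\<Sum>c'<c. col_height lam c' - 1)"

lemma below_top_mono: "c \<le> c' \<Longrightarrow> below_top lam c \<le> below_top lam c'"
  unfolding below_top_def by (rule sum_mono2) auto

lemma bfr_entry_below_top:
  "bfr_entry lam (0, c) = num_boxes lam - c"
  "r \<noteq> 0 \<Longrightarrow> bfr_entry lam (r, c) = below_top lam c + (col_height lam c - r)"
  by (simp_all add: below_top_def)

lemma finite_column: "is_partition lam \<Longrightarrow> finite {r. c < lam r}"
  by (rule finite_subset[of _ "{r. lam r \<noteq> 0}"]) (auto simp: is_partition_def)

lemma column:
  assumes "is_partition lam"
  shows "{r. c < lam r} = {..<col_height lam c}"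
proof -
  have down: "c < lam r'" if "c < lam r" "r' \<le> r" for r r'
    using assms that antimonoD[of lam r' r] by (auto simp: is_partition_def)
  have "r < col_height lam c" if "c < lam r" for r
  proof -
    have "{..r} \<subseteq> {r. c < lam r}" using down that by auto
    then have "card {..r} \<le> col_height lam c"
      unfolding col_height_def by (rule card_mono[OF finite_column[OF assms]])
    then show ?thesis by simp
  qed
  then have "{r. c < lam r} \<subseteq> {..<col_height lam c}" by auto
  then show ?thesis by (rule card_subset_eq[OF finite_lessThan]) (simp add: col_height_def)
qed

lemma diagram_iff: "is_partition lam \<Longrightarrow> (r, c) \<in> diagram lam \<longleftrightarrow> r < col_height lam c"
  using column[of lam c] by (auto simp: diagram_def)

lemma col_height_pos_iff: "is_partition lam \<Longrightarrow> 0 < col_height lam c \<longleftrightarrow> c < lam 0"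
  using diagram_iff[of lam 0 c] by (simp add: diagram_def)

text \<open>The top row has one box in each of the \<open>lam 0\<close> nonempty columns.\<close>

lemma num_boxes_below_top:
  assumes "is_partition lam"
  shows "num_boxes lam = below_top lam (lam 0) + lam 0"
proof -
  have "diagram lam = prod.swap ` (SIGMA c:{..<lam 0}. {..<col_height lam c})"
  proof -
    have "r < col_height lam c \<Longrightarrow> c < lam 0" for r c
      using col_height_pos_iff[OF assms, of c] by simp
    then show ?thesis by (auto simp: diagram_iff[OF assms] image_iff)
  qed
  then have "num_boxes lam = (\<Sum>c<lam 0. col_height lam c)"
    unfolding num_boxes_def by (simp add: card_image inj_on_def)
  also have "\<dots> = (\<Sum>c<lam 0. (col_height lam c - 1) + 1)"
    using col_height_pos_iff[OF assms] by (intro sum.cong refl) (simp add: Suc_leI)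
  also have "\<dots> = below_top lam (lam 0) + lam 0"
    unfolding sum.distrib by (simp add: below_top_def)
  finally show ?thesis .
qed

lemma tanisaki_generators_homogeneous:
  "tanisaki_generators lam \<subseteq> (\<Union>d. homogeneous_polys (num_boxes lam) d)"
proof
  fix g assume "g \<in> tanisaki_generators lam"
  then obtain i S where "g = elem_sym i S" "S \<subseteq> {1..num_boxes lam}"
    by (auto simp: tanisaki_generators_def elem_sym_set_def simp del: bfr_entry.simps)
  then show "g \<in> (\<Union>d. homogeneous_polys (num_boxes lam) d)"
    using elem_sym_homogeneous by blast
qed

lemma tanisaki_graded_ideal: "graded_ideal (num_boxes lam) (tanisaki_ideal lam)"
  unfolding tanisaki_ideal_def by (rule genideal_graded_ideal[OF tanisaki_generators_homogeneous])

lemma tanisaki_generators_subset: "tanisaki_generators lam \<subseteq> tanisaki_ideal lam"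
proof -
  interpret cring "poly_ring (num_boxes lam)" by (rule poly_ring_cring)
  show ?thesis
    unfolding tanisaki_ideal_def
    by (rule genideal_self)
      (use tanisaki_generators_homogeneous[of lam] in \<open>auto simp: homogeneous_polys_def\<close>)
qed

text \<open>Downward induction on the column \<open>c\<close>.  If \<open>i\<close> exceeds \<open>|S|\<close>, as it does beyond
  the diagram, then \<open>e\<^sub>i(S)\<close> is 0.  Otherwise, either \<open>i\<close> is an entry of column \<open>c\<close>
  or it also exceeds the bound of the next column, and then \<open>e\<^sub>i(S)\<close> is obtained by averaging, which divides by \<open>|S| - i\<close> and so uses characteristic 0.\<close>

lemma elem_sym_mem_tanisaki_ideal:
  assumes part: "is_partition lam" and "c \<le> num_boxes lam" "below_top lam c < i"
    and "S \<subseteq> {1..num_boxes lam}" "card S = num_boxes lam - c"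
  shows "elem_sym i S \<in> tanisaki_ideal lam"
  using assms(2-)
proof (induction c arbitrary: S rule: inc_induct)
  case base
  interpret graded_ideal "num_boxes lam" "tanisaki_ideal lam" by (rule tanisaki_graded_ideal)
  have "finite S" using base(2) finite_subset by blast
  then show ?case using base elem_sym_eq_0[of S i] ideal_zero by simp
next
  case (step c)
  interpret graded_ideal "num_boxes lam" "tanisaki_ideal lam" by (rule tanisaki_graded_ideal)
  let ?n = "num_boxes lam"
  have fin: "finite S" using step.prems(2) finite_subset by blast
  consider "card S < i" | "c < lam 0" "i \<le> ?n - c"
  proof (cases "c < lam 0")
    case False
    then have "below_top lam (lam 0) \<le> below_top lam c" by (intro below_top_mono) simp
    then have "card S < i" using step.prems num_boxes_below_top[OF part] False by simp
    then show ?thesis using that by blast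
  qed (use step.prems(3) that in linarith)
  then show ?case
  proof cases
    case 1
    then show ?thesis using elem_sym_eq_0[OF fin] ideal_zero by simp
  next
    case 2
    have height: "0 < col_height lam c" using 2 col_height_pos_iff[OF part] by simp
    have gen: "elem_sym i S \<in> tanisaki_ideal lam"
      if "r < col_height lam c" "bfr_entry lam (r, c) = i" for r
    proof -
      have "(r, c) \<in> diagram lam" using that(1) diagram_iff[OF part] by simp
      moreover have "elem_sym i S \<in> elem_sym_set ?n (bfr_entry lam (r, c)) (bfr_entry lam (0, c))"
        unfolding that(2) bfr_entry_below_top elem_sym_set_def using step.prems(2,3) by blast
      ultimately have "elem_sym i S \<in> tanisaki_generators lam"
        unfolding tanisaki_generators_def by blast
      then show ?thesis using tanisaki_generators_subset by blast
    qed
    consider "i = ?n - c" | "i < ?n - c" "i \<le> below_top lam (Suc c)" | "i < ?n - c" "below_top lam (Suc c) < i"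
      using 2 by linarith
    then show ?thesis
    proof cases
      case 1
      then show ?thesis using gen[OF height] bfr_entry_below_top(1) by simp
    next
      case 2
      \<comment> \<open>The row of column \<open>c\<close> that carries the entry \<open>i\<close>.\<close>
      define r where "r = col_height lam c - (i - below_top lam c)"
      have "i - below_top lam c \<le> col_height lam c - 1" using 2(2) by (simp add: below_top_def)
      then have r: "0 < r" "r < col_height lam c" "col_height lam c - r = i - below_top lam c"
        using step.prems(1) height by (auto simp: r_def)
      then show ?thesis using gen[OF r(2)] bfr_entry_below_top(2)[of r lam c] step.prems(1) by simp
    next
      case 3
      have mem: "elem_sym i (S - {x}) \<in> tanisaki_ideal lam" if "x \<in> S" for x
      proof (rule step.IH[OF 3(2)])
        show "S - {x} \<subseteq> {1..?n}" using step.prems(2) by blast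
        show "card (S - {x}) = ?n - Suc c" using step.prems(3) fin that by simp
      qed
      have "(\<Sum>x\<in>X. elem_sym i (S - {x})) \<in> tanisaki_ideal lam" if "finite X" "X \<subseteq> S" for X
        using that by (induction X rule: finite_induct) (auto simp: ideal_zero intro!: ideal_add mem)
      then have sum: "of_nat (card S - i) * elem_sym i S \<in> tanisaki_ideal lam"
        using sum_elem_sym_remove[OF fin, of i] fin by (metis order_refl)
      define k where "k = card S - i"
      have k: "k \<noteq> 0" using 3(1) step.prems(3) by (simp add: k_def)
      have cancel: "poly_const (1 / of_nat k) * (of_nat k * elem_sym i S) = elem_sym i S"
      proof -
        have "poly_const (1 / of_nat k) * of_nat k = (1 :: cpoly)"
          using k by (simp add: poly_const_def single_of_nat[symmetric] mult_single del: single_of_nat)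
        then show ?thesis by (simp add: mult.assoc[symmetric])
      qed
      from ideal_mult[OF poly_ring_const sum[folded k_def], of "1 / of_nat k"]
      show ?thesis unfolding cancel .
    qed
  qed
qed

text \<open>A generator \<open>e\<^sub>i(S)\<close> of column \<open>c\<close> pulls back to \<open>e\<^sub>i(P)\<close>, where \<open>P\<close> misses at most \<open>c\<close> elements,
  because \<open>S\<close> does; the bound on \<open>i\<close> only becomes weaker in a smaller diagram and an earlier column.\<close>

lemma tanisaki_ideal_pullback:
  assumes parts: "is_partition mu" "is_partition lam"
    and sub: "diagram mu \<subseteq> diagram lam"
    and f: "f \<in> fi_hom (num_boxes mu) (num_boxes lam)"
    and p: "p \<in> tanisaki_ideal lam"
  shows "poly_pullback (num_boxes mu) f p \<in> tanisaki_ideal mu"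
proof -
  let ?m = "num_boxes mu" and ?n = "num_boxes lam"
  interpret R: cring "poly_ring ?n" by (rule poly_ring_cring)
  interpret mu: graded_ideal ?m "tanisaki_ideal mu" by (rule tanisaki_graded_ideal)
  have inj: "inj_on f {1..?m}" and img: "f ` {1..?m} \<subseteq> {1..?n}" using f by (auto simp: fi_hom_def)
  have mn: "?m \<le> ?n" using card_inj_on_le[OF inj img] by simp
  define J where "J = {p \<in> carrier (poly_ring ?n). poly_pullback ?m f p \<in> tanisaki_ideal mu}"
  have "ideal J (poly_ring ?n)"
    by (rule poly_ring_idealI)
      (auto simp: J_def poly_ring_closed pullback_add pullback_mult[OF inj] mu.ideal_zero mu.ideal_add
        mu.ideal_mult pullback_carrier[OF inj])
  moreover have "tanisaki_generators lam \<subseteq> J"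
  proof
    fix g assume g: "g \<in> tanisaki_generators lam"
    then obtain r c S where rc: "(r, c) \<in> diagram lam" and S: "S \<subseteq> {1..?n}" "card S = ?n - c"
      and g_eq: "g = elem_sym (bfr_entry lam (r, c)) S"
      by (auto simp: tanisaki_generators_def elem_sym_set_def simp del: bfr_entry.simps)
         (auto simp: bfr_entry_below_top)
    let ?i = "bfr_entry lam (r, c)"
    have fin: "finite S" using S(1) finite_subset by blast
    have r: "r < col_height lam c" using rc diagram_iff[OF parts(2)] by simp
    then have c: "c < lam 0" using col_height_pos_iff[OF parts(2), of c] by simp
    have i: "below_top lam c < ?i"
    proof (cases "r = 0")
      case True
      have "below_top lam c \<le> below_top lam (lam 0)" using c by (intro below_top_mono) simp
      then show ?thesis using c num_boxes_below_top[OF parts(2)] True bfr_entry_below_top(1)[of lam c] by simp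
    next
      case False
      then show ?thesis using bfr_entry_below_top(2)[of r lam c] r by simp
    qed
    let ?P = "{k\<in>{1..?m}. f k \<in> S}"
    \<comment> \<open>Points of the image outside \<open>S\<close> are among the \<open>c\<close> points missed by \<open>S\<close>.\<close>
    have "?m - c \<le> card ?P"
    proof -
      have "card (f ` {1..?m} - S) \<le> card ({1..?n} - S)" using img by (intro card_mono) auto
      also have "\<dots> = ?n - card S" using S(1) fin by (simp add: card_Diff_subset)
      also have "\<dots> \<le> c" using S(2) by simp
      finally have le: "card (f ` {1..?m} - S) \<le> c" .
      have "f ` {1..?m} \<subseteq> f ` ?P \<union> (f ` {1..?m} - S)" by auto
      then have "card (f ` {1..?m}) \<le> card (f ` ?P \<union> (f ` {1..?m} - S))" by (intro card_mono) auto
      also have "\<dots> \<le> card (f ` ?P) + card (f ` {1..?m} - S)" by (rule card_Un_le)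
      finally have "?m \<le> card (f ` ?P) + c" using le card_image[OF inj] by simp
      also have "card (f ` ?P) \<le> card ?P" by (rule card_image_le) simp
      finally show ?thesis by simp
    qed
    moreover have "card ?P \<le> ?m" using card_mono[of "{1..?m}" ?P] by fastforce
    ultimately obtain c' where c': "c' \<le> c" "c' \<le> ?m" "card ?P = ?m - c'"
      by (intro that[of "?m - card ?P"]) auto
    have "below_top mu c' \<le> below_top mu c" by (rule below_top_mono[OF c'(1)])
    also have "\<dots> \<le> below_top lam c"
      unfolding below_top_def
    proof (intro sum_mono diff_le_mono)
      fix x
      have "{r. x < mu r} \<subseteq> {r. x < lam r}" using sub by (auto simp: diagram_def)
      then show "col_height mu x \<le> col_height lam x"
        unfolding col_height_def by (rule card_mono[OF finite_column[OF parts(2)]])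
    qed
    finally have "below_top mu c' < ?i" using i by linarith
    then have "elem_sym ?i ?P \<in> tanisaki_ideal mu"
      using c' by (intro elem_sym_mem_tanisaki_ideal[OF parts(1), of c']) auto
    then have "poly_pullback ?m f g \<in> tanisaki_ideal mu"
      unfolding g_eq pullback_elem_sym[OF f fin] .
    moreover have "g \<in> carrier (poly_ring ?n)"
      using g tanisaki_generators_homogeneous by (auto simp: homogeneous_polys_def)
    ultimately show "g \<in> J" by (simp add: J_def)
  qed
  ultimately have "tanisaki_ideal lam \<subseteq> J"
    unfolding tanisaki_ideal_def by (rule R.genideal_minimal)
  then show ?thesis using p by (auto simp: J_def)
qed

theorem theorem3:
  fixes Lam :: "nat \<Rightarrow> nat \<Rightarrow> nat"
  assumes "\<And>n. 1 \<le> n \<Longrightarrow> is_partition (Lam n)"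
    and "\<And>n. 1 \<le> n \<Longrightarrow> num_boxes (Lam n) = n"
    and "\<And>n. 1 \<le> n \<Longrightarrow> diagram (Lam n) \<subseteq> diagram (Lam (Suc n))"
  shows "cofi_finite_type (\<lambda>n. tanisaki_quot (Lam n)) (\<lambda>n. tanisaki_grading (Lam n))
      (tanisaki_pullback Lam)"
proof (rule stable_ideals.quotient_finite_type, rule stable_ideals.intro)
  have chain: "diagram (Lam m) \<subseteq> diagram (Lam n)" if "1 \<le> m" "m \<le> n" for m n
    using that(2)
  proof (induction n rule: dec_induct)
    case (step n)
    then show ?case using assms(3)[of n] that(1) by auto
  qed simp
  show "graded_ideal n (tanisaki_ideal (Lam n))" if "1 \<le> n" for n
    using tanisaki_graded_ideal[of "Lam n"] assms(2)[OF that] by simp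
  show "poly_pullback m f p \<in> tanisaki_ideal (Lam m)"
    if mnf: "1 \<le> m" "1 \<le> n" "f \<in> fi_hom m n" "p \<in> tanisaki_ideal (Lam n)" for m n f p
  proof -
    have "inj_on f {1..m}" "f ` {1..m} \<subseteq> {1..n}" using mnf(3) by (auto simp: fi_hom_def)
    then have "m \<le> n" using card_inj_on_le[of f "{1..m}" "{1..n}"] by simp
    then show ?thesis
      using tanisaki_ideal_pullback[OF assms(1)[OF mnf(1)] assms(1)[OF mnf(2)] chain[OF mnf(1)], of f p]
        assms(2)[OF mnf(1)] assms(2)[OF mnf(2)] mnf(3,4) by simp
  qed
qed (simp_all add: tanisaki_quot_def tanisaki_grading_def tanisaki_pullback_def assms(2))

end
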